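(* Let $\mathbb{K}$ be a field of characteristic $0$, let $S=\mathbb{K}[x_1,\dots,x_l]$ with the standard grading, and let $\mathcal{A}$ be a free (central) hyperplane arrangement in $\mathbb{K}^l$ with Jacobian ideal $J(\mathcal{A})\subseteq S$. Then $S/J(\mathcal{A})$ has the $l$-SLP.
   Context: A central hyperplane arrangement $\mathcal{A}=\{H_1,\dots,H_n\}$ in $\mathbb{K}^l$ is a finite set of hyperplanes $H_i=\alpha_i^{-1}(0)$ through the origin, with $\alpha_i\in S$ a linear form; $Q(\mathcal{A})=\prod_{i=1}^n\alpha_i$. Let $\mathrm{Der}_{\mathbb{K}^l}=\{\sum_{i=1}^lf_i\partial_{x_i}\mid f_i\in S\}$ and $D(\mathcal{A})=\{\delta\in\mathrm{Der}_{\mathbb{K}^l}\mid\delta(\alpha_i)\in\langle\alpha_i\rangle S\ \forall i\}$. $\mathcal{A}$ is free if $D(\mathcal{A})$ is a free $S$-module. The Jacobian ideal $J(\mathcal{A})$ is the ideal of $S$ generated by $Q(\mathcal{A})$ and all its partial derivatives. A linear map is full-rank if it is injective or surjective. A graded ring $R=\bigoplus_{i\ge0}R_i$ over $\mathbb{K}$ with $\dim_{\mathbb{K}}R_i<\infty$ (not necessarily Artinian) has the SLP with Lefschetz element $\ell\in R_1$ if $\times\ell^s\colon R_i\to R_{i+s}$ is full-rank for all $i\ge 0$, $s\ge1$. For $k\ge1$, $R$ has the $k$-SLP if there exist $\ell_1,\dots,\ell_k\in R_1$ such that $R$ has the SLP with Lefschetz element $\ell_1$ and, for all $i=2,\dots,k$,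 $R/\langle\ell_1,\dots,\ell_{i-1}\rangle$ has the SLP with Lefschetz element (the class of) $\ell_i$. *)

theory Defs
  imports
    "HOL-Library.Poly_Mapping"
    "HOL-Library.Function_Algebras"
    "HOL-Analysis.Finite_Cartesian_Product"
    "HOL-Algebra.QuotRing"
    "HOL-Algebra.Algebraic_Closure_Type"
begin

section \<open>Polynomials\<close>

text \<open>
  The variables are indexed by a finite type \<open>'n\<close>, so the number \<open>l\<close> of variables is
  \<open>CARD('n)\<close>. A polynomial maps each exponent vector to its coefficient; the multiplication of
  \<^theory>\<open>HOL-Library.Poly_Mapping\<close> is convolution, i.e. the product of polynomials.
\<close>

type_synonym ('a, 'n) mpoly = "('n \<Rightarrow>\<^sub>0 nat) \<Rightarrow>\<^sub>0 'a"

definition eval_mpoly :: "'a::comm_ring_1 ^ 'n::finite \<Rightarrow> ('a, 'n) mpoly \<Rightarrow> 'a" where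
  "eval_mpoly v p =
    (\<Sum>m\<in>Poly_Mapping.keys p. Poly_Mapping.lookup p m * (\<Prod>i\<in>UNIV. (v $ i) ^ Poly_Mapping.lookup m i))"

text \<open>The truncated subtraction of exponents is harmless: the coefficient vanishes whenever
  \<open>x\<^sub>i\<close> does not occur in the monomial.\<close>

definition partial :: "'n \<Rightarrow> ('a::comm_ring_1, 'n::finite) mpoly \<Rightarrow> ('a, 'n) mpoly" where
  "partial i p =
    (\<Sum>m\<in>Poly_Mapping.keys p.
       Poly_Mapping.single (m - Poly_Mapping.single i 1)
         (of_nat (Poly_Mapping.lookup m i) * Poly_Mapping.lookup p m))"

definition homogeneous_part :: "nat \<Rightarrow> ('a::comm_ring_1, 'n::finite) mpoly set" where
  "homogeneous_part d =
    {p. \<forall>m\<in>Poly_Mapping.keys p. (\<Sum>i\<in>UNIV. Poly_Mapping.lookup m i) = d}"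

abbreviation mpoly_ring :: "('a::comm_ring_1, 'n::finite) mpoly ring" where
  "mpoly_ring \<equiv> ring_of_type_algebra"


section \<open>Lefschetz properties of graded rings\<close>

text \<open>
  A graded ring is given by a ring \<open>R\<close> together with the family \<open>G\<close> of its homogeneous
  components.
\<close>

definition full_rank :: "('b \<Rightarrow> 'c) \<Rightarrow> 'b set \<Rightarrow> 'c set \<Rightarrow> bool" where
  "full_rank f V W \<longleftrightarrow> inj_on f V \<or> f ` V = W"

definition has_SLP_with :: "('r, 'm) ring_scheme \<Rightarrow> (nat \<Rightarrow> 'r set) \<Rightarrow> 'r \<Rightarrow> bool" where
  "has_SLP_with R G a \<longleftrightarrow> a \<in> G 1 \<and>
    (\<forall>i s. s \<ge> 1 \<longrightarrow> full_rank (\<lambda>x. (a [^]\<^bsub>R\<^esub> s) \<otimes>\<^bsub>R\<^esub> x) (G i) (G (i + s)))"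

definition quot_grading ::
    "('r, 'm) ring_scheme \<Rightarrow> (nat \<Rightarrow> 'r set) \<Rightarrow> 'r set \<Rightarrow> nat \<Rightarrow> 'r set set" where
  "quot_grading R G I = (\<lambda>i. (\<lambda>x. I +>\<^bsub>R\<^esub> x) ` G i)"

definition k_SLP :: "('r, 'm) ring_scheme \<Rightarrow> (nat \<Rightarrow> 'r set) \<Rightarrow> nat \<Rightarrow> bool" where
  "k_SLP R G k \<longleftrightarrow>
    (\<exists>L :: nat \<Rightarrow> 'r. (\<forall>i\<in>{1..k}. L i \<in> G 1) \<and>
      has_SLP_with R G (L 1) \<and>
      (\<forall>i\<in>{2..k}. let I = genideal R (L ` {1..i - 1})
         in has_SLP_with (R Quot I) (quot_grading R G I) (I +>\<^bsub>R\<^esub> L i)))"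


section \<open>Hyperplane arrangements\<close>

text \<open>
  An arrangement is a finite set of hyperplanes; \<open>\<alpha>\<close> chooses a defining linear form for each
  of them.
\<close>

definition central_arrangement ::
    "('a::field ^ 'n::finite) set set \<Rightarrow> (('a ^ 'n) set \<Rightarrow> ('a, 'n) mpoly) \<Rightarrow> bool" where
  "central_arrangement A \<alpha> \<longleftrightarrow> finite A \<and>
    (\<forall>H\<in>A. \<alpha> H \<in> homogeneous_part 1 \<and> \<alpha> H \<noteq> 0 \<and> H = {v. eval_mpoly v (\<alpha> H) = 0})"

definition defining_poly ::
    "('a::field ^ 'n::finite) set set \<Rightarrow> (('a ^ 'n) set \<Rightarrow> ('a, 'n) mpoly) \<Rightarrow> ('a, 'n) mpoly" where
  "defining_poly A \<alpha> = (\<Prod>H\<in>A. \<alpha> H)"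

definition jacobian_ideal ::
    "('a::field ^ 'n::finite) set set \<Rightarrow> (('a ^ 'n) set \<Rightarrow> ('a, 'n) mpoly) \<Rightarrow> ('a, 'n) mpoly set" where
  "jacobian_ideal A \<alpha> =
    genideal mpoly_ring (insert (defining_poly A \<alpha>) (range (\<lambda>i. partial i (defining_poly A \<alpha>))))"

definition derivations :: "(('a::field, 'n::finite) mpoly \<Rightarrow> ('a, 'n) mpoly) set" where
  "derivations = {\<delta>. \<exists>f. \<delta> = (\<lambda>p. \<Sum>i\<in>UNIV. f i * partial i p)}"

definition log_derivations ::
    "('a::field ^ 'n::finite) set set \<Rightarrow> (('a ^ 'n) set \<Rightarrow> ('a, 'n) mpoly)
      \<Rightarrow> (('a, 'n) mpoly \<Rightarrow> ('a, 'n) mpoly) set" where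
  "log_derivations A \<alpha> = {\<delta> \<in> derivations. \<forall>H\<in>A. \<alpha> H dvd \<delta> (\<alpha> H)}"

definition der_scale :: "'s::comm_ring_1 \<Rightarrow> ('s \<Rightarrow> 's) \<Rightarrow> ('s \<Rightarrow> 's)" where
  "der_scale f \<delta> = (\<lambda>p. f * \<delta> p)"

interpretation der: Modules.module der_scale
  by unfold_locales (auto simp: der_scale_def fun_eq_iff algebra_simps)

definition free_arrangement ::
    "('a::field ^ 'n::finite) set set \<Rightarrow> (('a ^ 'n) set \<Rightarrow> ('a, 'n) mpoly) \<Rightarrow> bool" where
  "free_arrangement A \<alpha> \<longleftrightarrow> (\<exists>B. der.independent B \<and> der.span B = log_derivations A \<alpha>)"

end

theory Submission
  imports Defs "HOL-Analysis.Cartesian_Space"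
begin

text \<open>
  Let \<open>Q\<close> be the defining polynomial and \<open>D\<close> the module of logarithmic derivations, i.e. those
  \<open>\<delta>\<close> with \<open>Q\<close> dividing \<open>\<delta> Q\<close>; it is the module of syzygies of \<open>Q, \<partial>\<^sub>1 Q, \<dots>, \<partial>\<^sub>l Q\<close>. Since \<open>D\<close>
  is free, \<open>S/J\<close> behaves like a Cohen-Macaulay ring of codimension two: linear forms
  \<open>\<ell>\<^sub>1, \<dots>, \<ell>\<^sub>l\<^sub>-\<^sub>2\<close> that are linearly independent together with any two of the forms \<open>\<alpha>\<^sub>H\<close> are a
  regular sequence on \<open>S/J\<close>, so multiplication by their powers is injective. This comes from the
  exactness on \<open>D\<close> of the Koszul complex of \<open>\<ell>\<^sub>k, Q, \<theta> Q\<close>, where \<open>\<theta>\<close> is a derivative in a direction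
  outside all hyperplanes; these three elements are a regular sequence modulo
  \<open>\<ell>\<^sub>1, \<dots>, \<ell>\<^sub>k\<^sub>-\<^sub>1\<close> because the restrictions of the \<open>\<alpha>\<^sub>H\<close> are pairwise non-proportional.
  What remains is an Artinian quotient of a polynomial ring in two variables. Dehomogenising
  turns each graded piece of the ideal into a space \<open>U\<close> of univariate polynomials, and at a
  generic point \<open>c\<close> no nonzero element of \<open>U\<close> vanishes to order \<open>dim U\<close>. Hence \<open>U\<close> is a complement of
  the multiples of \<open>(t - c)\<close> to the power \<open>dim U\<close>, which yields full rank for multiplication by any
  power of the corresponding linear form. After that the quotient is generated by powers of one
  linear form.
\<close>

section \<open>Polynomials in finitely many variables\<close>

text \<open>The ring as a module over itself: \<open>ideal.span\<close> is the generated ideal and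
  \<open>ideal.subspace\<close> the property of being an ideal.\<close>

interpretation ideal: Modules.module "(*) :: 'a::comm_ring_1 \<Rightarrow> 'a \<Rightarrow> 'a"
  by unfold_locales (auto simp: algebra_simps)

text \<open>In this instance the rule is associativity read backwards and would loop with
  \<open>mult.assoc\<close>.\<close>

declare ideal.scale_scale [simp del]

definition Const :: "'a::comm_ring_1 \<Rightarrow> ('a, 'n::finite) mpoly" where
  "Const c = Poly_Mapping.single 0 c"

definition Var :: "'n::finite \<Rightarrow> ('a::comm_ring_1, 'n) mpoly" where
  "Var i = Poly_Mapping.single (Poly_Mapping.single i 1) 1"

definition mdeg :: "('n::finite \<Rightarrow>\<^sub>0 nat) \<Rightarrow> nat" where
  "mdeg m = (\<Sum>i\<in>UNIV. Poly_Mapping.lookup m i)"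

section \<open>Ring homomorphisms\<close>

definition hom_on_ring :: "('a::comm_ring_1 \<Rightarrow> 'b::comm_ring_1) \<Rightarrow> bool" where
  "hom_on_ring \<phi> \<longleftrightarrow>
    (\<forall>a b. \<phi> (a + b) = \<phi> a + \<phi> b) \<and> (\<forall>a b. \<phi> (a * b) = \<phi> a * \<phi> b) \<and> \<phi> 1 = 1"

lemma hom_on_ring_zero: "hom_on_ring \<phi> \<Longrightarrow> \<phi> 0 = 0"
  unfolding hom_on_ring_def by (metis add_cancel_right_right)

lemma hom_on_ring_diff:
  assumes "hom_on_ring \<phi>" shows "\<phi> (a - b) = \<phi> a - \<phi> b"
proof -
  have "\<phi> (a - b) + \<phi> b = \<phi> a"
    using assms unfolding hom_on_ring_def by (metis diff_add_cancel)
  then show ?thesis by (simp add: eq_diff_eq)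
qed

lemma hom_on_ring_power: "hom_on_ring \<phi> \<Longrightarrow> \<phi> (a ^ n) = \<phi> a ^ n"
  by (induction n) (auto simp: hom_on_ring_def)

lemma hom_on_ring_sum: "hom_on_ring \<phi> \<Longrightarrow> \<phi> (sum f A) = (\<Sum>x\<in>A. \<phi> (f x))"
  by (induction A rule: infinite_finite_induct) (auto simp: hom_on_ring_zero, auto simp: hom_on_ring_def)

lemma hom_on_ring_comp: "hom_on_ring \<phi> \<Longrightarrow> hom_on_ring \<psi> \<Longrightarrow> hom_on_ring (\<lambda>x. \<psi> (\<phi> x))"
  by (auto simp: hom_on_ring_def)

section \<open>Monomials and homogeneous components\<close>

lemma mpoly_sum_monomials:
  fixes p :: "('a::comm_ring_1, 'n::finite) mpoly"
  shows "p = (\<Sum>m\<in>Poly_Mapping.keys p. Poly_Mapping.single m (Poly_Mapping.lookup p m))"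
proof (rule poly_mapping_eqI)
  fix k
  show "Poly_Mapping.lookup p k =
    Poly_Mapping.lookup (\<Sum>m\<in>Poly_Mapping.keys p. Poly_Mapping.single m (Poly_Mapping.lookup p m)) k"
    by (cases "k \<in> Poly_Mapping.keys p")
      (auto simp: lookup_sum lookup_single when_def in_keys_iff sum.delta)
qed

lemma mpoly_induct [case_names single add]:
  fixes p :: "('a::comm_ring_1, 'n::finite) mpoly"
  assumes s: "\<And>m c. P (Poly_Mapping.single m c)" and a: "\<And>p q. P p \<Longrightarrow> P q \<Longrightarrow> P (p + q)"
  shows "P p"
proof -
  have "P (\<Sum>m\<in>A. Poly_Mapping.single m (Poly_Mapping.lookup p m))" if "finite A" for A
    using that
  proof (induction A)
    case empty
    then show ?case using s[of 0 0] by simp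
  next
    case (insert x F)
    then show ?case using a s by simp
  qed
  then show ?thesis using mpoly_sum_monomials[of p] by (metis finite_keys)
qed

lemma mdeg_zero [simp]: "mdeg 0 = 0"
  by (simp add: mdeg_def)

lemma mdeg_add: "mdeg (a + b) = mdeg a + mdeg b"
  by (simp add: mdeg_def lookup_add sum.distrib)

lemma mdeg_single [simp]: "mdeg (Poly_Mapping.single i k) = k"
  by (simp add: mdeg_def lookup_single when_def)

lemma homogeneous_part_alt:
  "homogeneous_part d = {p. \<forall>m\<in>Poly_Mapping.keys p. mdeg m = d}"
  by (simp add: homogeneous_part_def mdeg_def)

lemma homogeneous_single: "mdeg m = d \<Longrightarrow> Poly_Mapping.single m c \<in> homogeneous_part d"
  by (simp add: homogeneous_part_alt)

lemma homogeneous_zero [simp]: "0 \<in> homogeneous_part d"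
  by (simp add: homogeneous_part_alt)

lemma homogeneous_add:
  "p \<in> homogeneous_part d \<Longrightarrow> q \<in> homogeneous_part d \<Longrightarrow> p + q \<in> homogeneous_part d"
  using keys_add[of p q] by (auto simp: homogeneous_part_alt)

lemma homogeneous_sum:
  "(\<And>x. x \<in> A \<Longrightarrow> f x \<in> homogeneous_part d) \<Longrightarrow> sum f A \<in> homogeneous_part d"
  by (induction A rule: infinite_finite_induct) (auto intro: homogeneous_add)

lemma homogeneous_uminus: "p \<in> homogeneous_part d \<Longrightarrow> - p \<in> homogeneous_part d"
  by (auto simp: homogeneous_part_alt in_keys_iff)

lemma homogeneous_diff:
  "p \<in> homogeneous_part d \<Longrightarrow> q \<in> homogeneous_part d \<Longrightarrow> p - q \<in> homogeneous_part d"
  using homogeneous_add[of p d "- q"] homogeneous_uminus[of q d] by simp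

lemma homogeneous_mult:
  "p \<in> homogeneous_part d \<Longrightarrow> q \<in> homogeneous_part e \<Longrightarrow> p * q \<in> homogeneous_part (d + e)"
  using keys_mult[of p q] by (fastforce simp: homogeneous_part_alt mdeg_add)

lemma homogeneous_Const [simp]: "Const c \<in> homogeneous_part 0"
  by (simp add: Const_def homogeneous_single)

lemma homogeneous_one [simp]: "1 \<in> homogeneous_part 0"
  using homogeneous_Const[of 1] by (simp add: Const_def)

lemma homogeneous_Var [simp]: "Var i \<in> homogeneous_part 1"
  by (simp add: Var_def homogeneous_single)

lemma homogeneous_scale: "p \<in> homogeneous_part d \<Longrightarrow> Const c * p \<in> homogeneous_part d"
  using homogeneous_mult[OF homogeneous_Const] by fastforce

lemma homogeneous_power: "p \<in> homogeneous_part 1 \<Longrightarrow> p ^ n \<in> homogeneous_part n"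
proof (induction n)
  case (Suc n)
  then show ?case using homogeneous_mult[of p 1 "p ^ n" n] by simp
qed simp

lemma mdeg_Suc_split:
  assumes "mdeg m = Suc d"
  obtains i m' where "m = Poly_Mapping.single i 1 + m'" "mdeg m' = d"
proof -
  have "mdeg m \<noteq> 0" using assms by simp
  then obtain i where i: "Poly_Mapping.lookup m i \<noteq> 0"
    unfolding mdeg_def by (meson sum.neutral)
  have m: "m = Poly_Mapping.single i 1 + (m - Poly_Mapping.single i 1)"
    using i by (intro poly_mapping_eqI) (auto simp: lookup_add lookup_minus lookup_single when_def)
  moreover have "mdeg (m - Poly_Mapping.single i 1) = d"
  proof -
    have "Suc d = 1 + mdeg (m - Poly_Mapping.single i 1)"
      using arg_cong[OF m, of mdeg] assms by (simp add: mdeg_add)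
    then show ?thesis by simp
  qed
  ultimately show ?thesis using that by blast
qed

text \<open>A monomial of degree \<open>Suc d\<close> is a variable times one of degree
  \<open>d\<close>, so forms arise from constants by adding forms of equal degree and multiplying by
  variables. The degree is an argument of \<open>P\<close> because it rises in the last
  case.\<close>

lemma homogeneous_induct [consumes 1, case_names Const add Var]:
  assumes f: "f \<in> homogeneous_part d"
    and C: "\<And>c. P 0 (Const c)"
    and A: "\<And>d f g. P d f \<Longrightarrow> P d g \<Longrightarrow> P d (f + g)"
    and V: "\<And>d f i. f \<in> homogeneous_part d \<Longrightarrow> P d f \<Longrightarrow> P (Suc d) (Var i * f)"
  shows "P d (f :: ('a::comm_ring_1, 'n::finite) mpoly)"
proof -
  have mono: "P d (Poly_Mapping.single m c)" if "mdeg m = d" for m d and c :: 'a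
    using that
  proof (induction d arbitrary: m)
    case 0
    then have "m = 0" by (intro poly_mapping_eqI) (simp add: mdeg_def)
    then show ?case using C[of c] by (simp add: Const_def)
  next
    case (Suc d)
    then obtain i m' where m: "m = Poly_Mapping.single i 1 + m'" "mdeg m' = d"
      using mdeg_Suc_split by blast
    have "Poly_Mapping.single m c = Var i * Poly_Mapping.single m' c"
      by (simp add: Var_def mult_single m(1))
    then show ?case using V[of "Poly_Mapping.single m' c" d i] Suc.IH[OF m(2)] m(2)
      by (simp add: homogeneous_single)
  qed
  \<comment> \<open>Zero as a monomial with coefficient 0; the arbitrary variable serves to give its
    exponent vector degree \<open>d\<close>.\<close>
  have zero: "P d 0"
    using mono[of "Poly_Mapping.single undefined d" d 0] by simp
  have "P d (\<Sum>m\<in>A. Poly_Mapping.single m (Poly_Mapping.lookup f m))"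
    if "finite A" "A \<subseteq> Poly_Mapping.keys f" for A
    using that
  proof (induction A)
    case (insert x F)
    then have "mdeg x = d" using f by (auto simp: homogeneous_part_alt)
    then show ?case using insert A mono by simp
  qed (simp add: zero)
  then show ?thesis using mpoly_sum_monomials[of f] by (metis finite_keys order_refl)
qed

section \<open>Substitution: point evaluation, endomorphisms and dehomogenisation in one
  notion\<close>

definition insertion ::
    "('a::comm_ring_1 \<Rightarrow> 'b::comm_ring_1) \<Rightarrow> ('n::finite \<Rightarrow> 'b) \<Rightarrow> ('a, 'n) mpoly \<Rightarrow> 'b" where
  "insertion \<phi> g p = (\<Sum>m\<in>Poly_Mapping.keys p.
     \<phi> (Poly_Mapping.lookup p m) * (\<Prod>i\<in>UNIV. g i ^ Poly_Mapping.lookup m i))"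

lemma insertion_superset:
  assumes "hom_on_ring \<phi>" "finite M" "Poly_Mapping.keys p \<subseteq> M"
  shows "insertion \<phi> g p = (\<Sum>m\<in>M.
     \<phi> (Poly_Mapping.lookup p m) * (\<Prod>i\<in>UNIV. g i ^ Poly_Mapping.lookup m i))"
  unfolding insertion_def using assms
  by (intro sum.mono_neutral_left) (auto simp: in_keys_iff hom_on_ring_zero)

lemma insertion_single:
  assumes "hom_on_ring \<phi>"
  shows "insertion \<phi> g (Poly_Mapping.single m c) = \<phi> c * (\<Prod>i\<in>UNIV. g i ^ Poly_Mapping.lookup m i)"
  using insertion_superset[OF assms, of "{m}" "Poly_Mapping.single m c" g] by simp

lemma insertion_add:
  assumes "hom_on_ring \<phi>"
  shows "insertion \<phi> g (p + q) = insertion \<phi> g p + insertion \<phi> g q"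
proof -
  let ?M = "Poly_Mapping.keys p \<union> Poly_Mapping.keys q"
  have "insertion \<phi> g (p + q) = (\<Sum>m\<in>?M.
     \<phi> (Poly_Mapping.lookup (p + q) m) * (\<Prod>i\<in>UNIV. g i ^ Poly_Mapping.lookup m i))"
    using insertion_superset[OF assms, of ?M "p + q"] keys_add[of p q] by simp
  also have "\<dots> = insertion \<phi> g p + insertion \<phi> g q"
    using insertion_superset[OF assms, of ?M p] insertion_superset[OF assms, of ?M q] assms
    by (simp add: lookup_add hom_on_ring_def algebra_simps sum.distrib)
  finally show ?thesis .
qed

lemma insertion_mult:
  assumes "hom_on_ring \<phi>"
  shows "insertion \<phi> g (p * q) = insertion \<phi> g p * insertion \<phi> g q"
proof (induction p rule: mpoly_induct)
  case (single m c)
  show ?case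
  proof (induction q rule: mpoly_induct)
    case (single m' c')
    show ?case using assms
      by (simp add: mult_single insertion_single lookup_add power_add prod.distrib hom_on_ring_def
          algebra_simps)
  next
    case (add p q)
    then show ?case by (simp add: insertion_add[OF assms] algebra_simps)
  qed
next
  case (add p q)
  then show ?case by (simp add: insertion_add[OF assms] algebra_simps)
qed

lemma insertion_Const: "hom_on_ring \<phi> \<Longrightarrow> insertion \<phi> g (Const c) = \<phi> c"
  by (simp add: Const_def insertion_single)

lemma insertion_Var: 
  assumes "hom_on_ring \<phi>"
  shows "insertion \<phi> g (Var i) = g i"
proof -
  have "insertion \<phi> g (Var i) = (\<Prod>j\<in>UNIV. g j ^ (1 when i = j))"
    using assms by (simp add: Var_def insertion_single lookup_single hom_on_ring_def)
  also have "\<dots> = (\<Prod>j\<in>UNIV. if j = i then g i else 1)"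
    by (intro prod.cong) (auto simp: when_def)
  finally show ?thesis by simp
qed

lemma hom_insertion: "hom_on_ring \<phi> \<Longrightarrow> hom_on_ring (insertion \<phi> g)"
  using insertion_Const[of \<phi> g 1]
  by (auto simp: hom_on_ring_def insertion_add insertion_mult Const_def)

lemma hom_Const: "hom_on_ring (Const :: 'a::comm_ring_1 \<Rightarrow> ('a, 'n::finite) mpoly)"
  by (auto simp: hom_on_ring_def Const_def single_add mult_single)

lemma eval_mpoly_insertion: "eval_mpoly v = insertion (\<lambda>x. x) (\<lambda>i. v $ i)"
  by (simp add: fun_eq_iff eval_mpoly_def insertion_def)

lemma hom_eval_mpoly: "hom_on_ring (eval_mpoly v)"
  unfolding eval_mpoly_insertion by (rule hom_insertion) (simp add: hom_on_ring_def)

lemma insertion_Const_Var: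
  fixes p :: "('a::comm_ring_1, 'n::finite) mpoly"
  shows "insertion Const Var p = p"
proof (induction p rule: mpoly_induct)
  case (single m c)
  have "(\<Prod>i\<in>A. (Var i :: ('a, 'n) mpoly) ^ Poly_Mapping.lookup m i) =
      Poly_Mapping.single (\<Sum>i\<in>A. Poly_Mapping.single i (Poly_Mapping.lookup m i)) 1" for A
  proof (induction A rule: infinite_finite_induct)
    case (insert x F)
    have "(Var x :: ('a, 'n) mpoly) ^ k = Poly_Mapping.single (Poly_Mapping.single x k) 1" for k
      by (induction k) (auto simp: Var_def mult_single single_add[symmetric])
    then show ?case using insert by (simp add: mult_single)
  qed auto
  moreover have "(\<Sum>i\<in>UNIV. Poly_Mapping.single i (Poly_Mapping.lookup m i)) = m"
    by (intro poly_mapping_eqI) (auto simp: lookup_sum lookup_single when_def)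
  ultimately show ?case
    by (subst insertion_single[OF hom_Const]) (simp add: Const_def mult_single)
next
  case (add p q)
  then show ?case by (simp add: insertion_add[OF hom_Const])
qed

text \<open>Congruence modulo an ideal is compatible with sums, products and powers. With
  \<open>insertion_Const_Var\<close>, a substitution that moves each variable by an element of
  \<open>I\<close> moves every polynomial by an element of \<open>I\<close>.\<close>

lemma insertion_cong_ideal:
  assumes "hom_on_ring \<phi>" "ideal.subspace I" "\<And>i. g i - h i \<in> I"
  shows "insertion \<phi> g p - insertion \<phi> h p \<in> I"
proof -
  have mul: "a * b - a' * b' \<in> I" if "a - a' \<in> I" "b - b' \<in> I" for a b a' b' :: 'b
  proof -
    have "a * b - a' * b' = b * (a - a') + a' * (b - b')" by (simp add: algebra_simps)
    then show ?thesis using that assms(2) by (metis ideal.subspace_add ideal.subspace_scale)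
  qed
  have pw: "g i ^ k - h i ^ k \<in> I" for i k
    by (induction k) (auto simp: ideal.subspace_0 assms intro: mul)
  have pr: "(\<Prod>i\<in>A. g i ^ Poly_Mapping.lookup m i) - (\<Prod>i\<in>A. h i ^ Poly_Mapping.lookup m i) \<in> I"
    for A m
    by (induction A rule: infinite_finite_induct) (auto simp: ideal.subspace_0 assms intro: mul pw)
  show ?thesis
  proof (induction p rule: mpoly_induct)
    case (single m c)
    show ?case using pr[where A = UNIV and m = m] assms
      by (auto simp: insertion_single intro!: mul ideal.subspace_0)
  next
    case (add p q)
    have "insertion \<phi> g (p + q) - insertion \<phi> h (p + q) =
      (insertion \<phi> g p - insertion \<phi> h p) + (insertion \<phi> g q - insertion \<phi> h q)"
      using assms(1) by (simp add: insertion_add)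
    then show ?case using add assms(2) by (metis ideal.subspace_add)
  qed
qed

section \<open>Uniqueness of digits and the absence of zero divisors\<close>

lemma digits_inj:
  fixes a b :: "nat \<Rightarrow> nat"
  assumes "(\<Sum>i<n. a i * N ^ i) = (\<Sum>i<n. b i * N ^ i)"
    and "\<And>i. i < n \<Longrightarrow> a i < N" "\<And>i. i < n \<Longrightarrow> b i < N" "i < n"
  shows "a i = b i"
  using assms
proof (induction n arbitrary: a b i)
  case (Suc n)
  have e: "(\<Sum>i<Suc n. c i * N ^ i) = c 0 + N * (\<Sum>i<n. c (Suc i) * N ^ i)" for c :: "nat \<Rightarrow> nat"
    by (subst sum.lessThan_Suc_shift) (simp add: sum_distrib_left algebra_simps)
  have eq: "a 0 + N * (\<Sum>i<n. a (Suc i) * N ^ i) = b 0 + N * (\<Sum>i<n. b (Suc i) * N ^ i)"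
    using Suc.prems(1) unfolding e .
  have lt: "a 0 < N" "b 0 < N" using Suc.prems by auto
  have z: "a 0 = b 0"
    using arg_cong[OF eq, of "\<lambda>x. x mod N"] lt by simp
  then have "(\<Sum>i<n. a (Suc i) * N ^ i) = (\<Sum>i<n. b (Suc i) * N ^ i)"
    using eq lt by simp
  then have "a (Suc j) = b (Suc j)" if "j < n" for j
    using Suc.IH[of "\<lambda>i. a (Suc i)" "\<lambda>i. b (Suc i)"] Suc.prems that by auto
  then show ?case using z Suc.prems(4) by (cases i) auto
qed simp

text \<open>Kronecker substitution \<open>x\<^sub>i \<mapsto> t\<^bsup>N\<^sup>i\<^esup>\<close> with \<open>N\<close> larger than all exponents involved.\<close>

lemma mpoly_mult_eq_0:
  fixes p q :: "('a::idom, 'n::finite) mpoly"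
  assumes "p * q = 0"
  shows "p = 0 \<or> q = 0"
proof (rule ccontr)
  assume ne: "\<not> (p = 0 \<or> q = 0)"
  let ?K = "Poly_Mapping.keys p \<union> Poly_Mapping.keys q"
  define N where "N = Suc (\<Sum>m\<in>?K. mdeg m)"
  have less: "Poly_Mapping.lookup m i < N" if "m \<in> ?K" for m i
  proof -
    have "Poly_Mapping.lookup m i \<le> mdeg m"
      unfolding mdeg_def by (rule member_le_sum) auto
    also have "\<dots> \<le> (\<Sum>m\<in>?K. mdeg m)" using that by (intro member_le_sum) auto
    finally show ?thesis by (simp add: N_def)
  qed
  \<comment> \<open>The index type carries no order, so a bijection with
    \<open>{..<CARD('n)}\<close> numbers the variables; \<open>w m\<close> is the exponent of
    \<open>t\<close> into which the monomial \<open>m\<close> is turned.\<close>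
  obtain h :: "nat \<Rightarrow> 'n" where h: "bij_betw h {..<CARD('n)} UNIV"
    using ex_bij_betw_nat_finite[of "UNIV :: 'n set"] by (auto simp: atLeast0LessThan)
  define k where "k = inv_into {..<CARD('n)} h"
  define w where "w m = (\<Sum>i\<in>UNIV. Poly_Mapping.lookup m i * N ^ k i)" for m :: "'n \<Rightarrow>\<^sub>0 nat"
  have w: "w m = (\<Sum>j<CARD('n). Poly_Mapping.lookup m (h j) * N ^ j)" for m
  proof -
    have "k (h j) = j" if "j < CARD('n)" for j
      using h that unfolding k_def bij_betw_def by auto
    then show ?thesis
      unfolding w_def using sum.reindex_bij_betw[OF h, of "\<lambda>i. Poly_Mapping.lookup m i * N ^ k i"]
      by simp
  qed
  have inj: "inj_on w ?K"
  proof (rule inj_onI, rule poly_mapping_eqI)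
    fix m m' i assume *: "m \<in> ?K" "m' \<in> ?K" "w m = w m'"
    obtain j where j: "j < CARD('n)" "i = h j" using h unfolding bij_betw_def by auto
    show "Poly_Mapping.lookup m i = Poly_Mapping.lookup m' i"
      using digits_inj[where n = "CARD('n)" and N = N and i = j
          and a = "\<lambda>j. Poly_Mapping.lookup m (h j)" and b = "\<lambda>j. Poly_Mapping.lookup m' (h j)"] * less j by (auto simp: w)
  qed
  let ?\<phi> = "\<lambda>c :: 'a. [:c:]"
  have hom: "hom_on_ring ?\<phi>" by (auto simp: hom_on_ring_def)
  define F where "F = insertion ?\<phi> (\<lambda>i :: 'n. monom (1::'a) (N ^ k i))"
  have pm: "(\<Prod>i\<in>A. monom (1::'a) (e i)) = monom 1 (\<Sum>i\<in>A. e i)" for A :: "'n set" and e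
    by (induction A rule: infinite_finite_induct) (auto simp: mult_monom)
  have F: "F r = (\<Sum>m\<in>Poly_Mapping.keys r. monom (Poly_Mapping.lookup r m) (w m))" for r
    unfolding F_def insertion_def
    by (intro sum.cong refl) (simp add: monom_power w_def pm smult_monom mult.commute)
  have nz: "F r \<noteq> 0" if r: "r \<noteq> 0" "Poly_Mapping.keys r \<subseteq> ?K" for r
  proof -
    obtain m where m: "m \<in> Poly_Mapping.keys r" using r(1) by (metis all_not_in_conv keys_eq_empty)
    \<comment> \<open>By injectivity of \<open>w\<close> no two monomials of \<open>r\<close> merge,
      so the coefficients of \<open>r\<close> survive in \<open>F r\<close>.\<close>
    have "coeff (F r) (w m) = (\<Sum>m'\<in>Poly_Mapping.keys r. if m' = m then Poly_Mapping.lookup r m else 0)"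
      unfolding F coeff_sum using inj r m
      by (intro sum.cong refl) (auto simp: dest: inj_onD)
    then show ?thesis using m by (auto simp: in_keys_iff)
  qed
  have "F p * F q = F (p * q)" unfolding F_def by (simp add: insertion_mult[OF hom])
  also have "\<dots> = 0" using assms by (simp add: F)
  finally show False using nz[of p] nz[of q] ne by auto
qed


section \<open>Linear forms and derivations\<close>

text \<open>Keeps the degree in \<open>homogeneous_part 1\<close> from turning into
  \<open>Suc 0\<close>, so that the rules on linear forms keep matching.\<close>

declare One_nat_def [simp del]

definition lin :: "'a::comm_ring_1 ^ 'n::finite \<Rightarrow> ('a, 'n) mpoly" where
  "lin c = (\<Sum>i\<in>UNIV. Const (c $ i) * Var i)"

lemma Const_add: "Const (a + b) = Const a + Const b"
  and Const_mult: "Const (a * b) = Const a * Const b"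
  and Const_0 [simp]: "Const 0 = 0"
  and Const_1 [simp]: "Const 1 = 1"
  by (auto simp: Const_def single_add mult_single)

lemma Const_inverse: "c \<noteq> 0 \<Longrightarrow> Const c * Const (inverse c) = 1" for c :: "'a::field"
  by (simp flip: Const_mult)

lemma lin_homogeneous [simp]: "lin c \<in> homogeneous_part 1"
  unfolding lin_def by (intro homogeneous_sum homogeneous_scale homogeneous_Var)

lemma lin_add: "lin (a + b) = lin a + lin b"
  by (simp add: lin_def Const_add algebra_simps sum.distrib)

lemma lin_scale: "lin (k *s a) = Const k * lin a"
  by (simp add: lin_def Const_mult sum_distrib_left mult.assoc)

lemma lin_zero [simp]: "lin 0 = 0"
  by (simp add: lin_def)

lemma lin_axis: "(lin (axis i 1) :: ('a::comm_ring_1, 'n::finite) mpoly) = Var i"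
proof -
  have "(lin (axis i 1) :: ('a, 'n) mpoly) = (\<Sum>j\<in>UNIV. if j = i then Var i else 0)"
    unfolding lin_def by (intro sum.cong) (auto simp: axis_def)
  then show ?thesis by simp
qed

lemma homogeneous_1_lin:
  fixes p :: "('a::comm_ring_1, 'n::finite) mpoly"
  assumes "p \<in> homogeneous_part 1"
  obtains c where "p = lin c"
proof -
  \<comment> \<open>Degree 0 is carried along because the induction reaches linear forms as
    variables times constants.\<close>
  have "(d = 0 \<longrightarrow> (\<exists>c. p = Const c)) \<and> (d = 1 \<longrightarrow> (\<exists>c. p = lin c))"
    if "p \<in> homogeneous_part d" for d and p :: "('a, 'n) mpoly"
    using that
  proof (induction d p rule: homogeneous_induct)
    case (add d f g)
    then show ?case by (metis Const_add lin_add)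
  next
    case (Var d f i)
    have "\<exists>v. Var i * Const c = lin v" for c :: 'a
      by (rule exI[of _ "c *s axis i 1"]) (simp add: lin_scale lin_axis mult.commute)
    then show ?case using Var by auto
  qed auto
  then show ?thesis using assms that by blast
qed

lemma insertion_lin:
  "hom_on_ring \<phi> \<Longrightarrow> insertion \<phi> g (lin c) = (\<Sum>i\<in>UNIV. \<phi> (c $ i) * g i)"
  by (simp add: lin_def hom_on_ring_sum[OF hom_insertion] insertion_mult insertion_Const
      insertion_Var)

lemma eval_mpoly_lin: "eval_mpoly v (lin c) = (\<Sum>i\<in>UNIV. c $ i * v $ i)"
  unfolding eval_mpoly_insertion by (rule insertion_lin) (simp add: hom_on_ring_def)

lemma lin_eq_0_iff [simp]: "lin c = 0 \<longleftrightarrow> c = 0"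
proof
  assume "lin c = 0"
  then have "eval_mpoly (axis i 1) (lin c) = 0" for i
    using hom_on_ring_zero[OF hom_eval_mpoly] by simp
  moreover have "eval_mpoly (axis i 1) (lin c) = c $ i" for i
    by (simp add: eval_mpoly_lin axis_def if_distrib[of "\<lambda>x. _ * x"] cong: if_cong)
  ultimately show "c = 0" by (simp add: vec_eq_iff)
qed simp

lemma linear_functional_dot:
  fixes T :: "'a::field ^ 'n::finite \<Rightarrow> 'b::ab_group_add"
  assumes "Vector_Spaces.linear (*s) sc T"
  shows "T c = (\<Sum>i\<in>UNIV. sc (c $ i) (T (axis i 1)))"
proof -
  interpret T: Vector_Spaces.linear "(*s)" sc T by fact
  have "T c = T (\<Sum>i\<in>UNIV. (c $ i) *s axis i 1)" by (simp add: basis_expansion)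
  then show ?thesis by (simp add: T.sum T.scale)
qed

lemma exists_linear_extension:
  fixes C :: "('a::field ^ 'n::finite) set" and sc :: "'a \<Rightarrow> 'b::ab_group_add \<Rightarrow> 'b"
  assumes "vector_space sc" "vec.independent C"
  obtains T where "Vector_Spaces.linear (*s) sc T" "\<And>c. c \<in> C \<Longrightarrow> T c = f c"
proof -
  interpret B: vector_space sc by fact
  interpret vector_space_pair "(*s) :: 'a \<Rightarrow> 'a ^ 'n \<Rightarrow> 'a ^ 'n" sc ..
  show ?thesis using linear_independent_extend[OF assms(2), of f] that by blast
qed

text \<open>A basis of the span of \<open>F\<close> together with \<open>c\<close> is independent,
  so some functional is 1 at \<open>c\<close> and 0 on the basis; \<open>v\<close> is its coordinate
  vector.\<close>

lemma exists_separating_vector: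
  fixes c :: "'a::field ^ 'n::finite"
  assumes "c \<notin> vec.span F"
  obtains v :: "'a ^ 'n" where "\<And>x. x \<in> F \<Longrightarrow> (\<Sum>i\<in>UNIV. x $ i * v $ i) = 0" "(\<Sum>i\<in>UNIV. c $ i * v $ i) = 1"
proof -
  obtain B where B: "B \<subseteq> F" "vec.independent B" "F \<subseteq> vec.span B"
    by (rule vec.maximal_independent_subset)
  then have "vec.span F \<subseteq> vec.span B" by (simp add: vec.span_minimal)
  moreover have "vec.span B \<subseteq> vec.span F" using B(1) by (rule vec.span_mono)
  ultimately have "c \<notin> vec.span B" using assms by auto
  then have ind: "vec.independent (insert c B)" using B(2) by (rule vec.independent_insertI)
  have vs: "vector_space ((*) :: 'a \<Rightarrow> 'a \<Rightarrow> 'a)" by unfold_locales (auto simp: algebra_simps)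
  obtain T where T: "Vector_Spaces.linear (*s) (*) T"
      "\<And>x. x \<in> insert c B \<Longrightarrow> T x = (if x = c then 1 else 0 :: 'a)"
    using exists_linear_extension[OF vs ind, of "\<lambda>x. if x = c then 1 else 0"] by metis
  interpret T: Vector_Spaces.linear "(*s)" "(*)" T by (rule T(1))
  define v where "v = (\<chi> i. T (axis i 1))"
  have dot: "(\<Sum>i\<in>UNIV. x $ i * v $ i) = T x" for x
    unfolding linear_functional_dot[OF T(1), of x] v_def by simp
  have "T x = 0" if "x \<in> vec.span B" for x
    using that
  proof (induction rule: vec.span_induct_alt)
    case (step k x y)
    then show ?case using T(2)[of x] \<open>c \<notin> vec.span B\<close> vec.span_base[of x B]
      by (auto simp: T.add T.scale)
  qed simp
  then have "T x = 0" if "x \<in> F" for x using B(3) that by auto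
  moreover have "T c = 1" using T(2) by simp
  ultimately show ?thesis using that[of v] by (simp add: dot)
qed

section \<open>Prime ideals generated by linear forms\<close>

lemma lin_notin_ideal:
  fixes c :: "'a::field ^ 'n::finite"
  assumes "c \<notin> vec.span F"
  shows "lin c \<notin> ideal.span (lin ` F)"
proof -
  obtain v where v: "\<And>x. x \<in> F \<Longrightarrow> eval_mpoly v (lin x) = 0" "eval_mpoly v (lin c) = 1"
    using exists_separating_vector[OF assms] by (metis eval_mpoly_lin)
  \<comment> \<open>Evaluation at the separating vector kills the generators and hence the ideal,
    but not \<open>lin c\<close>.\<close>
  have "eval_mpoly v p = 0" if "p \<in> ideal.span (lin ` F)" for p
    using that
  proof (induction rule: ideal.span_induct_alt)
    case base
    then show ?case using hom_on_ring_zero[OF hom_eval_mpoly] .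
  next
    case (step k x y)
    then show ?case using hom_eval_mpoly[of v] v(1) by (auto simp: hom_on_ring_def)
  qed
  then show ?thesis using v(2) by auto
qed

text \<open>Such an \<open>I\<close> is the kernel of the endomorphism \<sigma>, so the quotient
  embeds in a domain and \<open>I\<close> is prime. That \<sigma> keeps linear forms linear permits
  adding linear generators one at a time.\<close>

definition lin_prime :: "('a::comm_ring_1, 'n::finite) mpoly set \<Rightarrow> bool" where
  "lin_prime I \<longleftrightarrow> (\<exists>\<sigma>. hom_on_ring \<sigma> \<and> (\<forall>p\<in>homogeneous_part 1. \<sigma> p \<in> homogeneous_part 1) \<and>
     (\<forall>p. p - \<sigma> p \<in> I) \<and> (\<forall>p\<in>I. \<sigma> p = 0))"

lemma lin_prime_0: "lin_prime {0}"
  unfolding lin_prime_def by (rule exI[of _ "\<lambda>x. x"]) (auto simp: hom_on_ring_def)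

lemma lin_prime_one_notin: "lin_prime I \<Longrightarrow> 1 \<notin> I"
  unfolding lin_prime_def hom_on_ring_def by (metis zero_neq_one)

lemma lin_prime_mult:
  fixes I :: "('a::idom, 'n::finite) mpoly set"
  assumes "lin_prime I" "a * b \<in> I"
  shows "a \<in> I \<or> b \<in> I"
proof -
  obtain \<sigma> where s: "hom_on_ring \<sigma>" "\<And>p. p - \<sigma> p \<in> I" "\<And>p. p \<in> I \<Longrightarrow> \<sigma> p = 0"
    using assms(1) unfolding lin_prime_def by blast
  have "\<sigma> a * \<sigma> b = 0" using s(1) s(3)[OF assms(2)] by (simp add: hom_on_ring_def)
  then have "\<sigma> a = 0 \<or> \<sigma> b = 0" by (rule mpoly_mult_eq_0)
  then show ?thesis using s(2)[of a] s(2)[of b] by auto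
qed

lemma lin_prime_prod:
  fixes I :: "('a::idom, 'n::finite) mpoly set"
  assumes "lin_prime I" "finite A" "prod f A \<in> I"
  shows "\<exists>x\<in>A. f x \<in> I"
  using assms(2,3)
proof (induction A)
  case empty
  then show ?case using lin_prime_one_notin[OF assms(1)] by simp
next
  case (insert x F)
  then show ?case using lin_prime_mult[OF assms(1)] by auto
qed

text \<open>Solve \<open>\<alpha> = 0\<close> modulo \<open>I\<close> for a variable and substitute.\<close>

lemma lin_prime_insert:
  fixes Y :: "('a::field, 'n::finite) mpoly set"
  assumes I: "lin_prime (ideal.span Y)" and \<alpha>: "\<alpha> \<in> homogeneous_part 1" "\<alpha> \<notin> ideal.span Y"
  shows "lin_prime (ideal.span (insert \<alpha> Y))"
proof -
  let ?I = "ideal.span Y" and ?I' = "ideal.span (insert \<alpha> Y)"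
  obtain \<sigma> where s: "hom_on_ring \<sigma>" "\<And>p. p \<in> homogeneous_part 1 \<Longrightarrow> \<sigma> p \<in> homogeneous_part 1"
      "\<And>p. p - \<sigma> p \<in> ?I" "\<And>p. p \<in> ?I \<Longrightarrow> \<sigma> p = 0"
    using I unfolding lin_prime_def by blast
  have sub: "?I \<subseteq> ?I'" by (rule ideal.span_mono) auto
  have ne: "\<sigma> \<alpha> \<noteq> 0" using s(3)[of \<alpha>] \<alpha>(2) by auto
  obtain d where d: "\<sigma> \<alpha> = lin d" using s(2)[OF \<alpha>(1)] homogeneous_1_lin by blast
  obtain j where j: "d $ j \<noteq> 0" using ne unfolding d by (auto simp: vec_eq_iff)
  define g where "g i = (if i = j then Var j - Const (inverse (d $ j)) * \<sigma> \<alpha> else Var i)" for i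
  define \<tau> where "\<tau> = insertion Const g"
  have t: "hom_on_ring \<tau>" unfolding \<tau>_def by (rule hom_insertion[OF hom_Const])
  have gS: "g i \<in> homogeneous_part 1" for i
    unfolding g_def using s(2)[OF \<alpha>(1)] by (auto intro: homogeneous_diff homogeneous_scale)
  have t1: "\<tau> p \<in> homogeneous_part 1" if "p \<in> homogeneous_part 1" for p
  proof -
    obtain c where "p = lin c" using \<open>p \<in> homogeneous_part 1\<close> by (rule homogeneous_1_lin)
    then show ?thesis unfolding \<tau>_def
      by (simp add: insertion_lin[OF hom_Const] homogeneous_sum homogeneous_scale gS del: One_nat_def)
  qed
  have t2: "p - \<tau> p \<in> ideal.span {\<sigma> \<alpha>}" for p
  proof -
    have "insertion Const Var p - insertion Const g p \<in> ideal.span {\<sigma> \<alpha>}"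
    proof (rule insertion_cong_ideal[OF hom_Const])
      fix i show "Var i - g i \<in> ideal.span {\<sigma> \<alpha>}"
        by (auto simp: g_def ideal.span_zero intro: ideal.span_scale ideal.span_base)
    qed simp
    then show ?thesis by (simp add: \<tau>_def insertion_Const_Var)
  qed
  have t3: "\<tau> (\<sigma> \<alpha>) = 0"
  proof -
    have "\<tau> (\<sigma> \<alpha>) = (\<Sum>i\<in>UNIV. Const (d $ i) * g i)"
      unfolding d \<tau>_def by (rule insertion_lin[OF hom_Const])
    also have "\<dots> = (\<Sum>i\<in>UNIV. Const (d $ i) * Var i - (if i = j then \<sigma> \<alpha> else 0))"
      by (intro sum.cong refl)
        (auto simp: g_def right_diff_distrib mult.assoc[symmetric] Const_inverse[OF j])
    also have "\<dots> = 0" by (simp add: sum_subtractf d) (simp add: lin_def)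
    finally show ?thesis .
  qed
  have sa: "\<sigma> \<alpha> \<in> ?I'"
  proof -
    have "\<alpha> - (\<alpha> - \<sigma> \<alpha>) \<in> ?I'"
      by (rule ideal.span_diff[OF ideal.span_base subsetD[OF sub s(3)]]) simp
    moreover have "\<alpha> - (\<alpha> - \<sigma> \<alpha>) = \<sigma> \<alpha>" by simp
    ultimately show ?thesis by metis
  qed
  \<comment> \<open>The new endomorphism first reduces modulo the old ideal and then eliminates the
    variable \<open>j\<close>.\<close>
  show ?thesis
    unfolding lin_prime_def
  proof (intro exI[of _ "\<lambda>p. \<tau> (\<sigma> p)"] conjI ballI allI)
    show "hom_on_ring (\<lambda>p. \<tau> (\<sigma> p))" using s(1) t by (rule hom_on_ring_comp)
    show "\<tau> (\<sigma> p) \<in> homogeneous_part 1" if "p \<in> homogeneous_part 1" for p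
      using that s(2) t1 by blast
    show "p - \<tau> (\<sigma> p) \<in> ?I'" for p
    proof -
      have "ideal.span {\<sigma> \<alpha>} \<subseteq> ?I'" using sa by (intro ideal.span_minimal) auto
      then have "(p - \<sigma> p) + (\<sigma> p - \<tau> (\<sigma> p)) \<in> ?I'"
        using s(3)[of p] t2[of "\<sigma> p"] sub by (intro ideal.span_add) auto
      then show ?thesis by simp
    qed
    show "\<tau> (\<sigma> p) = 0" if p: "p \<in> ?I'" for p
    proof -
      obtain k where "p - k * \<alpha> \<in> ?I" using p by (auto simp: ideal.span_insert)
      then have "\<sigma> p = \<sigma> k * \<sigma> \<alpha>"
        using s(1) s(4) hom_on_ring_diff[OF s(1), of p "k * \<alpha>"] by (auto simp: hom_on_ring_def)
      then show ?thesis using t t3 by (simp add: hom_on_ring_def)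
    qed
  qed
qed

lemma lin_prime_independent:
  fixes F :: "('a::field ^ 'n::finite) set"
  assumes "vec.independent F"
  shows "lin_prime (ideal.span (lin ` F))"
proof -
  have "finite F" using assms by (rule vec.finiteI_independent)
  then show ?thesis using assms
  proof (induction F)
    case empty
    then show ?case by (simp add: lin_prime_0)
  next
    case (insert c F)
    then have "vec.independent F" "c \<notin> vec.span F" by (auto simp: vec.independent_insert)
    then show ?case using insert.IH lin_prime_insert[of "lin ` F" "lin c"] lin_notin_ideal
      by auto
  qed
qed

section \<open>Product rule and the module of derivations\<close>

lemma partial_superset:
  assumes "finite M" "Poly_Mapping.keys p \<subseteq> M"
  shows "partial i p = (\<Sum>m\<in>M. Poly_Mapping.single (m - Poly_Mapping.single i 1)
         (of_nat (Poly_Mapping.lookup m i) * Poly_Mapping.lookup p m))"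
  unfolding partial_def using assms by (intro sum.mono_neutral_left) (auto simp: in_keys_iff)

lemma partial_single:
  "partial i (Poly_Mapping.single m c) =
    Poly_Mapping.single (m - Poly_Mapping.single i 1) (of_nat (Poly_Mapping.lookup m i) * c)"
  using partial_superset[of "{m}" "Poly_Mapping.single m c" i] by simp

lemma partial_add: "partial i (p + q) = partial i p + partial i q"
proof -
  let ?M = "Poly_Mapping.keys p \<union> Poly_Mapping.keys q"
  show ?thesis
    using partial_superset[of ?M "p + q" i] partial_superset[of ?M p i] partial_superset[of ?M q i]
      keys_add[of p q]
    by (simp add: lookup_add algebra_simps sum.distrib single_add)
qed

lemma partial_zero [simp]: "partial i 0 = 0"
  by (simp add: partial_def)

lemma partial_mult: "partial i (p * q) = partial i p * q + p * partial i q"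
proof (induction p rule: mpoly_induct)
  case (single m c)
  show ?case
  proof (induction q rule: mpoly_induct)
    case (single m' c')
    \<comment> \<open>Truncated subtraction commutes with adding \<open>m'\<close> if
      \<open>i\<close> occurs in \<open>m\<close>; otherwise the coefficient is 0 on both
      sides.\<close>
    have e: "Poly_Mapping.single (m + m' - Poly_Mapping.single i 1) (of_nat (Poly_Mapping.lookup m i) * x)
      = Poly_Mapping.single (m - Poly_Mapping.single i 1 + m') (of_nat (Poly_Mapping.lookup m i) * x)"
      for m m' and x :: 'b
    proof (cases "Poly_Mapping.lookup m i = 0")
      case False
      then have "m + m' - Poly_Mapping.single i 1 = m - Poly_Mapping.single i 1 + m'"
        by (intro poly_mapping_eqI) (auto simp: lookup_add lookup_minus lookup_single when_def)
      then show ?thesis by simp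
    qed simp
    let ?e = "Poly_Mapping.single i 1 :: 'a \<Rightarrow>\<^sub>0 nat"
    have "partial i (Poly_Mapping.single m c * Poly_Mapping.single m' c') =
        Poly_Mapping.single (m + m' - ?e) (of_nat (Poly_Mapping.lookup m i) * (c * c')) +
        Poly_Mapping.single (m' + m - ?e) (of_nat (Poly_Mapping.lookup m' i) * (c * c'))"
      by (simp add: mult_single partial_single lookup_add distrib_right single_add add.commute[of m'])
    then show ?case
      unfolding e by (simp add: mult_single partial_single ac_simps)
  next
    case (add p q)
    then show ?case by (simp add: partial_add algebra_simps)
  qed
next
  case (add p q)
  then show ?case by (simp add: partial_add algebra_simps)
qed

lemma partial_Const [simp]: "partial i (Const c) = 0"
  by (simp add: Const_def partial_single)

lemma partial_Var: "partial i (Var j) = (if i = j then 1 else 0)"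
  by (auto simp: Var_def partial_single lookup_single when_def)

lemma partial_sum: "partial i (sum f A) = (\<Sum>x\<in>A. partial i (f x))"
  by (induction A rule: infinite_finite_induct) (auto simp: partial_add)

lemma partial_lin: "partial i (lin c) = Const (c $ i)"
  by (simp add: lin_def partial_sum partial_mult partial_Var if_distrib[of "\<lambda>x. _ * x"] cong: if_cong)

text \<open>The coefficients of a derivation are recovered as its values on the variables, which
  removes the existential quantifier and makes closure properties computable.\<close>

lemma derivations_iff:
  "\<delta> \<in> derivations \<longleftrightarrow> (\<forall>p. \<delta> p = (\<Sum>i\<in>UNIV. \<delta> (Var i) * partial i p))"
proof
  assume "\<delta> \<in> derivations"
  then obtain f where f: "\<delta> = (\<lambda>p. \<Sum>i\<in>UNIV. f i * partial i p)" by (auto simp: derivations_def)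
  then have "\<delta> (Var i) = f i" for i
    by (simp add: partial_Var if_distrib[of "\<lambda>x. _ * x"] cong: if_cong)
  then show "\<forall>p. \<delta> p = (\<Sum>i\<in>UNIV. \<delta> (Var i) * partial i p)" by (simp add: f)
next
  assume "\<forall>p. \<delta> p = (\<Sum>i\<in>UNIV. \<delta> (Var i) * partial i p)"
  then have "\<delta> = (\<lambda>p. \<Sum>i\<in>UNIV. \<delta> (Var i) * partial i p)" by (intro ext) (rule spec)
  then show "\<delta> \<in> derivations" 
    unfolding derivations_def by (intro CollectI exI)
qed

lemma derivation_mult:
  assumes "\<delta> \<in> derivations"
  shows "\<delta> (p * q) = \<delta> p * q + p * \<delta> q"
  using assms by (auto simp: derivations_def partial_mult algebra_simps sum.distrib sum_distrib_left)

lemma derivation_one: "\<delta> \<in> derivations \<Longrightarrow> \<delta> 1 = 0"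
  using derivation_mult[of \<delta> 1 1] by simp

lemma derivation_prod:
  assumes "\<delta> \<in> derivations" "finite A"
  shows "\<delta> (\<Prod>x\<in>A. f x) = (\<Sum>x\<in>A. \<delta> (f x) * (\<Prod>y\<in>A - {x}. f y))"
  using assms(2)
proof (induction A)
  case empty
  then show ?case using derivation_one[OF assms(1)] by simp
next
  case (insert a A)
  have "(\<Sum>x\<in>A. \<delta> (f x) * (\<Prod>y\<in>insert a A - {x}. f y)) =
      (\<Sum>x\<in>A. f a * (\<delta> (f x) * (\<Prod>y\<in>A - {x}. f y)))"
  proof (rule sum.cong[OF refl])
    fix x assume "x \<in> A"
    then have "insert a A - {x} = insert a (A - {x})" "a \<notin> A - {x}" using insert by auto
    then show "\<delta> (f x) * (\<Prod>y\<in>insert a A - {x}. f y) = f a * (\<delta> (f x) * (\<Prod>y\<in>A - {x}. f y))"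
      using insert by (simp add: ac_simps)
  qed
  then show ?case using insert derivation_mult[OF assms(1)] by (simp add: sum_distrib_left)
qed

lemma derivations_subspace:
  "der.subspace (derivations :: (('a::field, 'n::finite) mpoly \<Rightarrow> ('a, 'n) mpoly) set)"
proof (rule der.subspaceI)
  show "0 \<in> (derivations :: (('a, 'n) mpoly \<Rightarrow> ('a, 'n) mpoly) set)"
    by (simp add: derivations_iff)
next
  fix x y :: "('a, 'n) mpoly \<Rightarrow> ('a, 'n) mpoly"
  assume xy: "x \<in> derivations" "y \<in> derivations"
  show "x + y \<in> derivations"
    unfolding derivations_iff
  proof
    fix p
    have "(x + y) p = x p + y p" by simp
    also have "\<dots> = (\<Sum>i\<in>UNIV. x (Var i) * partial i p) + (\<Sum>i\<in>UNIV. y (Var i) * partial i p)"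
      using xy unfolding derivations_iff by metis
    also have "\<dots> = (\<Sum>i\<in>UNIV. (x + y) (Var i) * partial i p)"
      by (simp add: sum.distrib distrib_right)
    finally show "(x + y) p = (\<Sum>i\<in>UNIV. (x + y) (Var i) * partial i p)" .
  qed
next
  fix c and x :: "('a, 'n) mpoly \<Rightarrow> ('a, 'n) mpoly" assume x: "x \<in> derivations"
  show "der_scale c x \<in> derivations"
    unfolding derivations_iff
  proof
    fix p
    have "der_scale c x p = c * x p" by (simp add: der_scale_def)
    also have "\<dots> = c * (\<Sum>i\<in>UNIV. x (Var i) * partial i p)"
      using x unfolding derivations_iff by metis
    also have "\<dots> = (\<Sum>i\<in>UNIV. der_scale c x (Var i) * partial i p)"
      by (simp add: der_scale_def sum_distrib_left mult.assoc)
    finally show "der_scale c x p = (\<Sum>i\<in>UNIV. der_scale c x (Var i) * partial i p)" .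
  qed
qed


section \<open>Regular sequences on the Jacobian ring\<close>

definition nzd_mod :: "'s::comm_ring_1 \<Rightarrow> 's set \<Rightarrow> bool" where
  "nzd_mod p N \<longleftrightarrow> (\<forall>f. p * f \<in> N \<longrightarrow> f \<in> N)"

lemma ideal_span_insertE:
  fixes x :: "'s::comm_ring_1"
  assumes "x \<in> ideal.span (insert a Y)"
  obtains k y where "x = k * a + y" "y \<in> ideal.span Y"
proof -
  obtain k where "x - k * a \<in> ideal.span Y" using assms by (auto simp: ideal.span_insert)
  then show ?thesis using that[of k "x - k * a"] by simp
qed

lemma ideal_span_insertI:
  fixes x :: "'s::comm_ring_1"
  shows "y \<in> ideal.span Y \<Longrightarrow> k * a + y \<in> ideal.span (insert a Y)"
  by (auto simp: ideal.span_insert intro: exI[of _ k])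

lemma sum_fun_apply: "(sum f A) x = (\<Sum>a\<in>A. f a x)"
  for f :: "'c \<Rightarrow> 'b \<Rightarrow> 'd::comm_monoid_add"
  by (induction A rule: infinite_finite_induct) auto

section \<open>Derivations with prescribed coefficients and Jacobian syzygies\<close>

definition der_of :: "('n \<Rightarrow> ('a::field, 'n::finite) mpoly) \<Rightarrow> ('a, 'n) mpoly \<Rightarrow> ('a, 'n) mpoly" where
  "der_of f p = (\<Sum>i\<in>UNIV. f i * partial i p)"

lemma der_of_derivation [simp]: "der_of f \<in> derivations"
  unfolding derivations_def der_of_def[abs_def] by blast

lemma der_of_Var [simp]: "der_of f (Var i) = f i"
  by (simp add: der_of_def partial_Var if_distrib[of "\<lambda>x. _ * x"] cong: if_cong)

lemma derivation_expand:
  assumes "\<delta> \<in> derivations"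
  shows "\<delta> p = (\<Sum>i\<in>UNIV. \<delta> (Var i) * partial i p)"
  using assms unfolding derivations_iff by blast

lemma derivation_in_ideal:
  assumes "\<delta> \<in> derivations" "\<And>i. \<delta> (Var i) \<in> ideal.span Y"
  shows "\<delta> p \<in> ideal.span Y"
  unfolding derivation_expand[OF assms(1), of p]
proof (rule ideal.span_sum)
  fix i show "\<delta> (Var i) * partial i p \<in> ideal.span Y"
    using ideal.span_scale[OF assms(2)[of i], of "partial i p"] by (simp add: mult.commute)
qed

abbreviation jac_gens :: "('a::field, 'n::finite) mpoly \<Rightarrow> ('a, 'n) mpoly set" where
  "jac_gens Q \<equiv> insert Q (range (\<lambda>i. partial i Q))"

text \<open>Combinations of the partial derivatives of \<open>Q\<close> are exactly the values at
  \<open>Q\<close> of derivations. Membership in the Jacobian ideal thus becomes a statement on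
  derivations, up to \<open>Q\<close> and \<open>Y\<close>.\<close>

lemma jac_span_iff:
  fixes Q :: "('a::field, 'n::finite) mpoly"
  shows "m \<in> ideal.span (Y \<union> jac_gens Q) \<longleftrightarrow>
    (\<exists>\<epsilon>\<in>derivations. m - \<epsilon> Q \<in> ideal.span (insert Q Y))"
proof
  assume "m \<in> ideal.span (Y \<union> jac_gens Q)"
  then show "\<exists>\<epsilon>\<in>derivations. m - \<epsilon> Q \<in> ideal.span (insert Q Y)"
  proof (induction rule: ideal.span_induct_alt)
    case base
    show ?case using der.subspace_0[OF derivations_subspace]
      by (intro bexI[of _ 0]) (auto simp: ideal.span_zero)
  next
    case (step k x y)
    then obtain \<epsilon> where e: "\<epsilon> \<in> derivations" "y - \<epsilon> Q \<in> ideal.span (insert Q Y)" by blast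
    show ?case
    proof (cases "x \<in> insert Q Y")
      case True
      then have "k * x + (y - \<epsilon> Q) \<in> ideal.span (insert Q Y)"
        by (intro ideal.span_add ideal.span_scale ideal.span_base e)
      then show ?thesis using e(1) by (intro bexI[of _ \<epsilon>]) (auto simp: algebra_simps)
    next
      case False
      then obtain i where x: "x = partial i Q" using step by auto
      define \<eta> where "\<eta> = der_of (\<lambda>j. if j = i then k else 0)"
      have "\<eta> Q = k * x" unfolding \<eta>_def der_of_def x
        by (simp add: if_distrib[of "\<lambda>x. x * _"] cong: if_cong)
      moreover have "\<eta> + \<epsilon> \<in> derivations"
        using e(1) by (intro der.subspace_add[OF derivations_subspace]) (auto simp: \<eta>_def)
      ultimately show ?thesis using e(2) by (intro bexI[of _ "\<eta> + \<epsilon>"]) auto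
    qed
  qed
next
  assume "\<exists>\<epsilon>\<in>derivations. m - \<epsilon> Q \<in> ideal.span (insert Q Y)"
  then obtain \<epsilon> where e: "\<epsilon> \<in> derivations" "m - \<epsilon> Q \<in> ideal.span (insert Q Y)" by blast
  have "ideal.span (insert Q Y) \<subseteq> ideal.span (Y \<union> jac_gens Q)" by (rule ideal.span_mono) auto
  moreover have "\<epsilon> Q \<in> ideal.span (Y \<union> jac_gens Q)"
    unfolding derivation_expand[OF e(1), of Q]
    by (intro ideal.span_sum ideal.span_scale ideal.span_base) auto
  ultimately have "(m - \<epsilon> Q) + \<epsilon> Q \<in> ideal.span (Y \<union> jac_gens Q)"
    using e(2) by (intro ideal.span_add) auto
  then show "m \<in> ideal.span (Y \<union> jac_gens Q)" by simp
qed

text \<open>Syzygies of \<open>(Q, \<partial>\<^sub>1 Q, \<dots>)\<close> modulo \<open>Y\<close> lift to logarithmic derivations.\<close>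

definition syz_lift :: "('a::field, 'n::finite) mpoly \<Rightarrow> ('a, 'n) mpoly set \<Rightarrow> bool" where
  "syz_lift Q Y \<longleftrightarrow> (\<forall>\<delta>\<in>derivations. \<delta> Q \<in> ideal.span (insert Q Y) \<longrightarrow>
    (\<exists>\<delta>'\<in>derivations. Q dvd \<delta>' Q \<and> (\<forall>i. \<delta> (Var i) - \<delta>' (Var i) \<in> ideal.span Y)))"

lemma syz_lift_empty: "syz_lift (Q :: ('a::field, 'n::finite) mpoly) {}"
  unfolding syz_lift_def
proof (intro ballI impI)
  fix \<delta> :: "('a, 'n) mpoly \<Rightarrow> ('a, 'n) mpoly"
  assume "\<delta> \<in> derivations" "\<delta> Q \<in> ideal.span {Q}"
  then show "\<exists>\<delta>'\<in>derivations. Q dvd \<delta>' Q \<and> (\<forall>i. \<delta> (Var i) - \<delta>' (Var i) \<in> ideal.span {})"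
    by (intro bexI[of _ \<delta>]) (auto simp: ideal.span_singleton)
qed

text \<open>
  Modulo \<open>Y\<close>, the relation \<open>r m = a Q + h Q\<close> yields an element \<open>Q a\<close> of the free module \<open>D\<close>
  with \<open>p (Q a) \<in> (r, Q) D\<close>; as \<open>p\<close> is a non-zero-divisor modulo \<open>(r, Q)\<close>, the coordinates
  of \<open>Q a\<close> lie in \<open>(r, Q)\<close>. This is the exactness of the Koszul complex of \<open>r, Q, p\<close> on \<open>D\<close>.
\<close>

lemma nzd_mod_jacobian_step:
  fixes Q r :: "('a::field, 'n::finite) mpoly"
  assumes B: "der.independent B" and D: "der.span B = {\<delta> \<in> derivations. Q dvd \<delta> Q}"
    and \<theta>: "\<theta> \<in> derivations"
    and r: "nzd_mod r (ideal.span Y)" and q: "nzd_mod Q (ideal.span (insert r Y))"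
    and p: "nzd_mod (\<theta> Q) (ideal.span (insert Q (insert r Y)))"
    and lift: "syz_lift Q Y"
  shows "nzd_mod r (ideal.span (Y \<union> jac_gens Q))"
  unfolding nzd_mod_def
proof (intro allI impI)
  fix m assume rm: "r * m \<in> ideal.span (Y \<union> jac_gens Q)"
  let ?I = "ideal.span Y" and ?Ir = "ideal.span (insert r Y)"
    and ?Irq = "ideal.span (insert Q (insert r Y))"
  let ?p = "\<theta> Q"
  have sub1: "?I \<subseteq> ?Ir" and sub2: "?Ir \<subseteq> ?Irq"
    by (rule ideal.span_mono, blast)+
  obtain a where a: "a \<in> derivations" "r * m - a Q \<in> ideal.span (insert Q Y)"
    using rm unfolding jac_span_iff by blast
  obtain h y where hy: "r * m - a Q = h * Q + y" "y \<in> ?I"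
    using a(2) by (rule ideal_span_insertE)
  \<comment> \<open>As \<open>?p\<close> is \<open>\<theta> Q\<close>, the value of \<open>e\<close>
    at \<open>Q\<close> is a multiple of \<open>r * m - a Q\<close> and lies in
    \<open>(Q, Y)\<close>. So \<open>e\<close> is a syzygy modulo \<open>Y\<close> and lifts to a
    logarithmic derivation \<open>d\<close>.\<close>
  define e where "e = der_scale ?p a - der_scale (r * m) \<theta>"
  have e_der: "e \<in> derivations"
    unfolding e_def using a(1) \<theta>
    by (intro der.subspace_diff der.subspace_scale derivations_subspace)
  have "e Q = - ?p * (r * m - a Q)" by (simp add: e_def der_scale_def algebra_simps)
  then have "e Q \<in> ideal.span (insert Q Y)" using a(2) by (metis ideal.span_scale)
  then obtain d where d: "d \<in> derivations" "Q dvd d Q" "\<And>i. e (Var i) - d (Var i) \<in> ?I"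
    using lift e_der unfolding syz_lift_def by blast
  \<comment> \<open>Multiplication by \<open>Q\<close> moves every derivation into the free module,
    where coordinates with respect to \<open>B\<close> exist.\<close>
  define x where "x = der_scale Q a"
  have scaleD: "der_scale Q \<delta> \<in> der.span B" if "\<delta> \<in> derivations" for \<delta>
    using that der.subspace_scale[OF derivations_subspace that] by (auto simp: D der_scale_def)
  have xD: "x \<in> der.span B" unfolding x_def by (rule scaleD[OF a(1)])
  have dD: "d \<in> der.span B" using d by (simp add: D)
  define z where "z = der_scale Q (e - d)"
  have ed: "e - d \<in> derivations" by (intro der.subspace_diff derivations_subspace e_der d)
  have zD: "z \<in> der.span B" unfolding z_def by (rule scaleD[OF ed])
  define t where "t = der_scale Q (der_scale m \<theta>)"
  have tD: "t \<in> der.span B" unfolding t_def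
    by (intro scaleD der.subspace_scale derivations_subspace \<theta>)
  \<comment> \<open>This places \<open>p x\<close> in \<open>(r, Q) D\<close> up to the error
    \<open>z\<close>.\<close>
  have rel: "der_scale ?p x = der_scale r t + (der_scale Q d + z)"
    by (simp add: fun_eq_iff x_def t_def z_def e_def der_scale_def algebra_simps)
  let ?del = "\<lambda>i. der_of (\<lambda>j. if j = i then 1 else 0) :: ('a, 'n) mpoly \<Rightarrow> ('a, 'n) mpoly"
  have del: "?del i s = partial i s" for i s
    by (simp add: der_of_def if_distrib[of "\<lambda>x. x * _"] cong: if_cong)
  define dl where "dl i = der_scale Q (?del i)" for i
  have dlD: "dl i \<in> der.span B" for i unfolding dl_def by (intro scaleD der_of_derivation)
  \<comment> \<open>The error is a combination of the elements \<open>dl i\<close> of the free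
    module with coefficients in \<open>(Y)\<close>, so its coordinates lie in \<open>(Y)\<close>
    too.\<close>
  have rep_z: "der.representation B z b \<in> ?I" for b
  proof -
    have "z = (\<Sum>i\<in>UNIV. der_scale (e (Var i) - d (Var i)) (dl i))"
    proof
      fix s
      have "z s = Q * (e - d) s" by (simp add: z_def der_scale_def)
      also have "\<dots> = Q * (\<Sum>i\<in>UNIV. (e - d) (Var i) * partial i s)"
        using derivation_expand[OF ed] by metis
      also have "\<dots> = (\<Sum>i\<in>UNIV. (e (Var i) - d (Var i)) * (Q * ?del i s))"
        unfolding del by (simp add: sum_distrib_left ac_simps)
      finally show "z s = (\<Sum>i\<in>UNIV. der_scale (e (Var i) - d (Var i)) (dl i)) s"
        by (simp add: sum_fun_apply der_scale_def dl_def)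
    qed
    then have "der.representation B z b =
        (\<Sum>i\<in>UNIV. (e (Var i) - d (Var i)) * der.representation B (dl i) b)"
      using B dlD
      by (simp add: der.representation_sum der.representation_scale der.span_scale)
    also have "\<dots> \<in> ?I"
    proof (rule ideal.span_sum)
      fix i show "(e (Var i) - d (Var i)) * der.representation B (dl i) b \<in> ?I"
        by (subst mult.commute) (rule ideal.span_scale[OF d(3)])
    qed
    finally show ?thesis .
  qed
  have rep_x: "der.representation B x b \<in> ?Irq" for b
  proof -
    have "?p * der.representation B x b = der.representation B (der_scale ?p x) b"
      using B xD by (simp add: der.representation_scale)
    also have "\<dots> = Q * der.representation B d b + (r * der.representation B t b +
        der.representation B z b)"
      unfolding rel using B xD dD zD tD
      by (simp add: der.representation_scale der.representation_add der.span_add der.span_scale)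
    also have "\<dots> = der.representation B d b * Q + (der.representation B t b * r +
        der.representation B z b)"
      by (simp add: mult.commute)
    also have "\<dots> \<in> ?Irq" by (intro ideal_span_insertI rep_z)
    finally show ?thesis using p unfolding nzd_mod_def by blast
  qed
  then have "\<exists>w. der.representation B x b - w * Q \<in> ?Ir" for b
    by (auto simp: ideal.span_insert[of Q])
  then obtain w where w: "der.representation B x b - w b * Q \<in> ?Ir" for b by metis
  \<comment> \<open>\<open>W\<close> is \<open>x\<close> divided by \<open>Q\<close> coordinatewise,
    modulo \<open>(r, Y)\<close>. It is logarithmic, and cancelling \<open>Q\<close> modulo
    \<open>(r, Y)\<close> shows that it agrees there with \<open>a\<close>.\<close>
  define W where "W = (\<Sum>b | der.representation B x b \<noteq> 0. der_scale (w b) b)"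
  have WD: "W \<in> der.span B"
    unfolding W_def
    by (intro der.span_sum der.span_scale der.span_base) (auto dest: der.representation_ne_zero)
  then have W_der: "W \<in> derivations" and "Q dvd W Q" using D by auto
  then obtain h' where h': "W Q = Q * h'" by blast
  have aW: "a (Var i) - W (Var i) \<in> ?Ir" for i
  proof -
    have x_rep: "x = (\<Sum>b | der.representation B x b \<noteq> 0. der_scale (der.representation B x b) b)"
      using der.sum_nonzero_representation_eq[OF B xD] by simp
    have "x (Var i) = (\<Sum>b | der.representation B x b \<noteq> 0. der.representation B x b * b (Var i))"
      by (subst x_rep) (simp add: sum_fun_apply der_scale_def)
    then have "Q * (a (Var i) - W (Var i)) =
        (\<Sum>b | der.representation B x b \<noteq> 0. b (Var i) * (der.representation B x b - w b * Q))"
      by (simp add: x_def W_def sum_fun_apply der_scale_def sum_distrib_left right_diff_distrib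
          sum_subtractf ac_simps)
    also have "\<dots> \<in> ?Ir" by (intro ideal.span_sum ideal.span_scale w)
    finally show ?thesis using q unfolding nzd_mod_def by blast
  qed
  then have "\<exists>c. a (Var i) - W (Var i) - c * r \<in> ?I" for i
    by (auto simp: ideal.span_insert[of r])
  then obtain c where c: "a (Var i) - W (Var i) - c i * r \<in> ?I" for i by metis
  define \<epsilon> where "\<epsilon> = der_of c"
  have "(a - W - der_scale r \<epsilon>) Q \<in> ?I"
  proof (rule derivation_in_ideal[where \<delta> = "a - W - der_scale r \<epsilon>"])
    show "a - W - der_scale r \<epsilon> \<in> derivations" unfolding \<epsilon>_def
      by (intro der.subspace_diff der.subspace_scale derivations_subspace a(1) W_der der_of_derivation)
    show "(a - W - der_scale r \<epsilon>) (Var i) \<in> ?I" for i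
      using c[of i] by (simp add: \<epsilon>_def der_scale_def mult.commute[of r])
  qed
  then have y': "a Q - W Q - r * \<epsilon> Q \<in> ?I" by (simp add: der_scale_def)
  \<comment> \<open>With \<open>W\<close> and \<open>r\<close> times \<epsilon> removed from
    \<open>a\<close>, the relation reads \<open>r (m - \<epsilon> Q) = (h + h') Q\<close> modulo
    \<open>Y\<close>. Cancelling \<open>Q\<close> modulo \<open>(r, Y)\<close> makes
    \<open>h + h'\<close> a multiple of \<open>r\<close> modulo \<open>Y\<close>; then
    \<open>r\<close> itself cancels.\<close>
  have eq: "r * (m - \<epsilon> Q) - (h + h') * Q = (a Q - W Q - r * \<epsilon> Q) + y"
    using hy(1) h' by (simp add: algebra_simps) 
  then have 1: "r * (m - \<epsilon> Q) - (h + h') * Q \<in> ?I"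
    using y' hy(2) by (metis ideal.span_add)
  have "Q * (h + h') = (m - \<epsilon> Q) * r + - (r * (m - \<epsilon> Q) - (h + h') * Q)"
    by (simp add: algebra_simps)
  also have "\<dots> \<in> ?Ir" by (intro ideal_span_insertI ideal.span_neg 1)
  finally have "h + h' \<in> ?Ir" using q unfolding nzd_mod_def by blast
  then obtain k y2 where k: "h + h' = k * r + y2" "y2 \<in> ?I" by (rule ideal_span_insertE)
  have y2: "y2 = h + h' - k * r" using k(1) by simp
  have "r * (m - \<epsilon> Q - k * Q) = (r * (m - \<epsilon> Q) - (h + h') * Q) + Q * y2"
    unfolding y2 by (simp add: algebra_simps)
  also have "\<dots> \<in> ?I" by (intro ideal.span_add ideal.span_scale 1 k(2))
  finally have "m - \<epsilon> Q - k * Q \<in> ?I" using r unfolding nzd_mod_def by blast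
  then have "k * Q + (m - \<epsilon> Q - k * Q) \<in> ideal.span (insert Q Y)" by (rule ideal_span_insertI)
  then have "m - \<epsilon> Q \<in> ideal.span (insert Q Y)" by simp
  then show "m \<in> ideal.span (Y \<union> jac_gens Q)"
    unfolding jac_span_iff \<epsilon>_def by (intro bexI[of _ "der_of c"] der_of_derivation)
qed

text \<open>Regularity of \<open>r\<close> on the Jacobian quotient allows a syzygy modulo
  \<open>(r, Y)\<close> to be corrected by \<open>r\<close> times a derivation into a syzygy modulo
  \<open>Y\<close>, which lifts by assumption.\<close>

lemma syz_lift_step:
  fixes Q r :: "('a::field, 'n::finite) mpoly"
  assumes nzd: "nzd_mod r (ideal.span (Y \<union> jac_gens Q))" and lift: "syz_lift Q Y"
  shows "syz_lift Q (insert r Y)"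
  unfolding syz_lift_def
proof (intro ballI impI)
  fix \<delta> :: "('a, 'n) mpoly \<Rightarrow> ('a, 'n) mpoly"
  assume \<delta>: "\<delta> \<in> derivations" "\<delta> Q \<in> ideal.span (insert Q (insert r Y))"
  then have "\<delta> Q \<in> ideal.span (insert r (insert Q Y))" by (simp add: insert_commute)
  then obtain m y where my: "\<delta> Q = m * r + y" "y \<in> ideal.span (insert Q Y)"
    by (rule ideal_span_insertE)
  have "r * m - \<delta> Q = - y" using my by (simp add: algebra_simps)
  then have "r * m \<in> ideal.span (Y \<union> jac_gens Q)"
    unfolding jac_span_iff using \<delta>(1) my(2) by (intro bexI[of _ \<delta>]) (auto intro: ideal.span_neg)
  then have "m \<in> ideal.span (Y \<union> jac_gens Q)" using nzd unfolding nzd_mod_def by blast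
  then obtain \<epsilon> where e: "\<epsilon> \<in> derivations" "m - \<epsilon> Q \<in> ideal.span (insert Q Y)"
    unfolding jac_span_iff by blast
  define \<eta> where "\<eta> = \<delta> - der_scale r \<epsilon>"
  have "\<eta> \<in> derivations" unfolding \<eta>_def
    by (intro der.subspace_diff der.subspace_scale derivations_subspace \<delta>(1) e(1))
  moreover have "\<eta> Q = r * (m - \<epsilon> Q) + y" by (simp add: \<eta>_def der_scale_def my algebra_simps)
  then have "\<eta> Q \<in> ideal.span (insert Q Y)" using e(2) my(2)
    by (metis ideal.span_add ideal.span_scale)
  ultimately obtain \<delta>' where d: "\<delta>' \<in> derivations" "Q dvd \<delta>' Q"
      "\<And>i. \<eta> (Var i) - \<delta>' (Var i) \<in> ideal.span Y"
    using lift unfolding syz_lift_def by blast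
  have "\<delta> (Var i) - \<delta>' (Var i) \<in> ideal.span (insert r Y)" for i
  proof -
    have "\<delta> (Var i) - \<delta>' (Var i) = \<epsilon> (Var i) * r + (\<eta> (Var i) - \<delta>' (Var i))"
      by (simp add: \<eta>_def der_scale_def algebra_simps)
    then show ?thesis using ideal_span_insertI[OF d(3)] by metis
  qed
  then show "\<exists>\<delta>'\<in>derivations. Q dvd \<delta>' Q \<and>
      (\<forall>i. \<delta> (Var i) - \<delta>' (Var i) \<in> ideal.span (insert r Y))"
    using d by blast
qed

text \<open>The two steps alternate: lifting modulo the first \<open>k\<close> forms gives
  regularity of the next one, and this gives lifting modulo \<open>k + 1\<close> forms.\<close>

lemma nzd_mod_jacobian:
  fixes Q :: "('a::field, 'n::finite) mpoly" and r :: "nat \<Rightarrow> ('a, 'n) mpoly"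
  assumes B: "der.independent B" and D: "der.span B = {\<delta> \<in> derivations. Q dvd \<delta> Q}"
    and \<theta>: "\<theta> \<in> derivations"
    and r: "\<And>k. k < n \<Longrightarrow> nzd_mod (r k) (ideal.span (r ` {..<k}))"
    and q: "\<And>k. k < n \<Longrightarrow> nzd_mod Q (ideal.span (r ` {..k}))"
    and p: "\<And>k. k < n \<Longrightarrow> nzd_mod (\<theta> Q) (ideal.span (insert Q (r ` {..k})))"
    and k: "k < n"
  shows "nzd_mod (r k) (ideal.span (r ` {..<k} \<union> jac_gens Q))"
proof -
  have ins: "insert (r k) (r ` {..<k}) = r ` {..k}" "insert (r k) (r ` {..<k}) = r ` {..<Suc k}" for k :: nat
    by (auto simp: less_Suc_eq le_less)
  have step: "nzd_mod (r k) (ideal.span (r ` {..<k} \<union> jac_gens Q))"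
    if "k < n" "syz_lift Q (r ` {..<k})" for k
    using nzd_mod_jacobian_step[OF B D \<theta> r, of k] q[of k] p[of k] that by (simp add: ins)
  have "k \<le> n \<Longrightarrow> syz_lift Q (r ` {..<k})" for k
  proof (induction k)
    case 0
    then show ?case by (simp add: syz_lift_empty)
  next
    case (Suc k)
    then show ?case using syz_lift_step[OF step[of k]] ins(2)[of k] by simp
  qed
  then show ?thesis using step k by simp
qed

section \<open>Products of pairwise coprime forms\<close>

lemma nzd_mod_lin_prime:
  fixes I :: "('a::idom, 'n::finite) mpoly set"
  assumes "lin_prime I" "a \<notin> I"
  shows "nzd_mod a I"
  unfolding nzd_mod_def using lin_prime_mult[OF assms(1), of a] assms(2) by blast

text \<open>Models the restriction of the forms to the common zeros of \<open>Y\<close>: modulo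
  \<open>Y\<close> they are nonzero primes, pairwise not associated.\<close>

locale coprime_forms =
  fixes A :: "'h set" and \<alpha> :: "'h \<Rightarrow> ('a::field, 'n::finite) mpoly" and Y :: "('a, 'n) mpoly set"
  assumes fin: "finite A" and prime0: "lin_prime (ideal.span Y)"
    and prime: "\<And>H. H \<in> A \<Longrightarrow> lin_prime (ideal.span (insert (\<alpha> H) Y))"
    and nonzero: "\<And>H. H \<in> A \<Longrightarrow> \<alpha> H \<notin> ideal.span Y"
    and distinct: "\<And>H K. H \<in> A \<Longrightarrow> K \<in> A \<Longrightarrow> H \<noteq> K \<Longrightarrow> \<alpha> K \<notin> ideal.span (insert (\<alpha> H) Y)"
begin

lemma nzd_prod: "nzd_mod (\<Prod>H\<in>A. \<alpha> H) (ideal.span Y)"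
proof (rule nzd_mod_lin_prime[OF prime0], rule notI)
  assume "(\<Prod>H\<in>A. \<alpha> H) \<in> ideal.span Y"
  then show False using lin_prime_prod[OF prime0 fin] nonzero by blast
qed

text \<open>One factor is split off at a time: the product of the earlier forms is outside the prime
  ideal of the next one, so the cofactor must be inside.\<close>

lemma Inter_span:
  assumes "T \<subseteq> A" "\<And>H. H \<in> T \<Longrightarrow> f \<in> ideal.span (insert (\<alpha> H) Y)"
  shows "f \<in> ideal.span (insert (\<Prod>H\<in>T. \<alpha> H) Y)"
proof -
  have "finite T" using assms(1) fin by (rule finite_subset)
  then show ?thesis using assms
  proof (induction T)
    case empty
    have "f * 1 \<in> ideal.span (insert 1 Y)" by (intro ideal.span_scale ideal.span_base) simp
    then show ?case by simp
  next
    case (insert H T)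
    let ?P = "ideal.span (insert (\<alpha> H) Y)"
    have "f \<in> ideal.span (insert (\<Prod>H\<in>T. \<alpha> H) Y)" using insert by auto
    then obtain k y where ky: "f = k * (\<Prod>H\<in>T. \<alpha> H) + y" "y \<in> ideal.span Y"
      by (rule ideal_span_insertE)
    have "y \<in> ?P" using ky(2) ideal.span_mono[of Y "insert (\<alpha> H) Y"] by auto
    then have "f - y \<in> ?P" using insert.prems(2)[of H] by (intro ideal.span_diff) auto
    then have "k * (\<Prod>H\<in>T. \<alpha> H) \<in> ?P" by (simp add: ky(1))
    moreover have P: "lin_prime ?P" using insert.prems by (intro prime) auto
    moreover have "(\<Prod>H\<in>T. \<alpha> H) \<notin> ?P"
      using lin_prime_prod[OF P insert.hyps(1), of \<alpha>] distinct insert by blast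
    ultimately have "k \<in> ?P" using lin_prime_mult by blast
    then obtain k' y' where k': "k = k' * \<alpha> H + y'" "y' \<in> ideal.span Y"
      by (rule ideal_span_insertE)
    have "f = k' * (\<alpha> H * (\<Prod>H\<in>T. \<alpha> H)) + ((\<Prod>H\<in>T. \<alpha> H) * y' + y)"
      by (simp add: ky(1) k'(1) algebra_simps)
    also have "\<dots> \<in> ideal.span (insert (\<alpha> H * (\<Prod>H\<in>T. \<alpha> H)) Y)"
      by (intro ideal_span_insertI ideal.span_add ideal.span_scale k'(2) ky(2))
    finally show ?case using insert by simp
  qed
qed

text \<open>In the Leibniz sum every term other than the one differentiating
  \<open>\<alpha> H\<close> still contains the factor \<open>\<alpha> H\<close>.\<close>

lemma derivation_prod_mod:
  assumes "\<theta> \<in> derivations" "H \<in> A"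
  shows "\<exists>k. \<theta> (\<Prod>H\<in>A. \<alpha> H) = k * \<alpha> H + \<theta> (\<alpha> H) * (\<Prod>K\<in>A - {H}. \<alpha> K)"
proof -
  have "\<alpha> H dvd (\<Sum>K\<in>A - {H}. \<theta> (\<alpha> K) * (\<Prod>L\<in>A - {K}. \<alpha> L))"
    using assms fin by (intro dvd_sum dvd_mult dvd_prodI) auto
  then obtain k where "(\<Sum>K\<in>A - {H}. \<theta> (\<alpha> K) * (\<Prod>L\<in>A - {K}. \<alpha> L)) = \<alpha> H * k" by blast
  then show ?thesis
    unfolding derivation_prod[OF assms(1) fin] sum.remove[OF fin assms(2)]
    by (intro exI[of _ k]) (simp add: mult.commute)
qed

lemma others_notin:
  assumes "H \<in> A"
  shows "(\<Prod>K\<in>A - {H}. \<alpha> K) \<notin> ideal.span (insert (\<alpha> H) Y)"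
proof
  assume "(\<Prod>K\<in>A - {H}. \<alpha> K) \<in> ideal.span (insert (\<alpha> H) Y)"
  then obtain K where "K \<in> A - {H}" "\<alpha> K \<in> ideal.span (insert (\<alpha> H) Y)"
    using lin_prime_prod[OF prime[OF assms], of "A - {H}" \<alpha>] fin by blast
  then show False using distinct[OF assms, of K] by blast
qed

text \<open>Modulo the prime of \<open>\<alpha> H\<close> the derivative is
  \<open>\<theta> (\<alpha> H)\<close> times the other forms, and none of these factors is in the
  prime. So \<open>f\<close> lies in every such prime, hence in their intersection, which
  \<open>Inter_span\<close> describes.\<close>

lemma nzd_derivation_prod:
  assumes "\<theta> \<in> derivations" "\<And>H. H \<in> A \<Longrightarrow> \<theta> (\<alpha> H) \<notin> ideal.span (insert (\<alpha> H) Y)"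
  shows "nzd_mod (\<theta> (\<Prod>H\<in>A. \<alpha> H)) (ideal.span (insert (\<Prod>H\<in>A. \<alpha> H) Y))"
  unfolding nzd_mod_def
proof (intro allI impI)
  let ?Q = "\<Prod>H\<in>A. \<alpha> H"
  fix f assume f: "\<theta> ?Q * f \<in> ideal.span (insert ?Q Y)"
  show "f \<in> ideal.span (insert ?Q Y)"
  proof (rule Inter_span[OF subset_refl])
    fix H assume H: "H \<in> A"
    let ?P = "ideal.span (insert (\<alpha> H) Y)"
    have aP: "\<alpha> H \<in> ?P" by (rule ideal.span_base) simp
    have "?Q = (\<Prod>K\<in>A - {H}. \<alpha> K) * \<alpha> H" using prod.remove[OF fin H, of \<alpha>] by (simp add: mult.commute)
    then have "?Q \<in> ?P" using ideal.span_scale[OF aP] by metis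
    moreover have "Y \<subseteq> ?P" by (auto intro: ideal.span_base)
    ultimately have "ideal.span (insert ?Q Y) \<subseteq> ?P" by (intro ideal.span_minimal) auto
    then have "\<theta> ?Q * f \<in> ?P" using f by auto
    moreover have "\<theta> ?Q \<notin> ?P"
    proof
      assume *: "\<theta> ?Q \<in> ?P"
      obtain k where k: "\<theta> ?Q = k * \<alpha> H + \<theta> (\<alpha> H) * (\<Prod>K\<in>A - {H}. \<alpha> K)"
        using derivation_prod_mod[OF assms(1) H] by blast
      have "\<theta> ?Q - k * \<alpha> H \<in> ?P" using * aP by (intro ideal.span_diff ideal.span_scale)
      then have "\<theta> (\<alpha> H) * (\<Prod>K\<in>A - {H}. \<alpha> K) \<in> ?P" by (simp add: k)
      then show False using lin_prime_mult[OF prime[OF H]] assms(2)[OF H] others_notin[OF H] by blast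
    qed
    ultimately show "f \<in> ?P" using lin_prime_mult[OF prime[OF H]] by blast
  qed
qed

end

text \<open>Reconciles logarithmic derivations of the arrangement with those of its defining
  polynomial: modulo \<open>\<alpha> H\<close> the derivative of the product is
  \<open>\<delta> (\<alpha> H)\<close> times a factor outside the prime. With \<open>Y\<close>
  empty, membership in the span is divisibility.\<close>

lemma (in coprime_forms) log_derivation_iff:
  assumes "Y = {}" "\<delta> \<in> derivations"
  shows "(\<Prod>H\<in>A. \<alpha> H) dvd \<delta> (\<Prod>H\<in>A. \<alpha> H) \<longleftrightarrow> (\<forall>H\<in>A. \<alpha> H dvd \<delta> (\<alpha> H))"
proof
  have P: "f \<in> ideal.span (insert g Y) \<longleftrightarrow> g dvd f" for f g
    unfolding assms(1) ideal.span_singleton by (auto simp: dvd_def mult.commute)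
  {
    assume *: "(\<Prod>H\<in>A. \<alpha> H) dvd \<delta> (\<Prod>H\<in>A. \<alpha> H)"
    show "\<forall>H\<in>A. \<alpha> H dvd \<delta> (\<alpha> H)"
    proof
      fix H assume H: "H \<in> A"
      obtain k where k: "\<delta> (\<Prod>H\<in>A. \<alpha> H) = k * \<alpha> H + \<delta> (\<alpha> H) * (\<Prod>K\<in>A - {H}. \<alpha> K)"
        using derivation_prod_mod[OF assms(2) H] by blast
      have "\<alpha> H dvd (\<Prod>H\<in>A. \<alpha> H)" using fin H by (rule dvd_prodI)
      then have "\<alpha> H dvd \<delta> (\<Prod>H\<in>A. \<alpha> H)" using * by (rule dvd_trans)
      then have "\<alpha> H dvd \<delta> (\<alpha> H) * (\<Prod>K\<in>A - {H}. \<alpha> K)" unfolding k by (simp add: dvd_add_right_iff)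
      then show "\<alpha> H dvd \<delta> (\<alpha> H)"
        using lin_prime_mult[OF prime[OF H]] others_notin[OF H] unfolding P by blast
    qed
  }
  {
    assume *: "\<forall>H\<in>A. \<alpha> H dvd \<delta> (\<alpha> H)"
    have "\<delta> (\<Prod>H\<in>A. \<alpha> H) \<in> ideal.span (insert (\<Prod>H\<in>A. \<alpha> H) Y)"
    proof (rule Inter_span[OF subset_refl])
      fix H assume H: "H \<in> A"
      obtain k where k: "\<delta> (\<Prod>H\<in>A. \<alpha> H) = k * \<alpha> H + \<delta> (\<alpha> H) * (\<Prod>K\<in>A - {H}. \<alpha> K)"
        using derivation_prod_mod[OF assms(2) H] by blast
      then show "\<delta> (\<Prod>H\<in>A. \<alpha> H) \<in> ideal.span (insert (\<alpha> H) Y)"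
        unfolding P using * H by simp
    qed
    then show "(\<Prod>H\<in>A. \<alpha> H) dvd \<delta> (\<Prod>H\<in>A. \<alpha> H)" by (simp add: P)
  }
qed


section \<open>Two variables\<close>

interpretation poly_vs: vector_space "smult :: 'a::field \<Rightarrow> 'a poly \<Rightarrow> 'a poly"
  by unfold_locales (auto simp: smult_add_right smult_add_left)

text \<open>
  Wronskian argument: for \<open>u \<in> U\<close>, the map \<open>w \<mapsto> u w' - u' w\<close> kills \<open>u\<close> and lowers the order of
  vanishing at \<open>c\<close> by at most one, provided \<open>u(c) \<noteq> 0\<close>.
\<close>

lemma finite_high_order_points:
  fixes U :: "'a::field_char_0 poly set"
  assumes "finite U" "card U \<le> m"
  shows "finite {c. \<exists>w\<in>poly_vs.span U. w \<noteq> 0 \<and> [:- c, 1:] ^ m dvd w}"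
  using assms
proof (induction m arbitrary: U)
  case 0
  then show ?case by simp
next
  case (Suc m)
  show ?case
  proof (cases "U \<subseteq> {0}")
    case True
    then have "poly_vs.span U \<subseteq> {0}" by (intro poly_vs.span_minimal) auto
    then have "{c. \<exists>w\<in>poly_vs.span U. w \<noteq> 0 \<and> [:- c, 1:] ^ Suc m dvd w} = {}" by blast
    then show ?thesis by (metis finite.emptyI)
  next
    case False
    then obtain u where u: "u \<in> U" "u \<noteq> 0" by auto
    define \<phi> where "\<phi> w = u * pderiv w - pderiv u * w" for w
    have lin: "Vector_Spaces.linear smult smult \<phi>"
      by unfold_locales
        (auto simp: \<phi>_def pderiv_add pderiv_smult algebra_simps smult_diff_right smult_add_right)
    interpret \<phi>: Vector_Spaces.linear smult smult \<phi> by (rule lin)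
    define U' where "U' = \<phi> ` (U - {u})"
    have "card U' \<le> m"
      using Suc.prems u(1) card_image_le[of "U - {u}" \<phi>] unfolding U'_def by simp
    then have fin: "finite {c. \<exists>w\<in>poly_vs.span U'. w \<noteq> 0 \<and> [:- c, 1:] ^ m dvd w}"
      using Suc.prems(1) by (intro Suc.IH) (auto simp: U'_def)
    have "\<phi> u = 0" by (simp add: \<phi>_def mult.commute)
    have "\<phi> w \<in> poly_vs.span U'" if "w \<in> U" for w
    proof (cases "w = u")
      case True
      then show ?thesis using \<open>\<phi> u = 0\<close> poly_vs.span_zero by simp
    next
      case False
      then show ?thesis unfolding U'_def using that by (intro poly_vs.span_base imageI) simp
    qed
    then have "\<phi> ` U \<subseteq> poly_vs.span U'" by (rule image_subsetI)
    then have span: "\<phi> w \<in> poly_vs.span U'" if "w \<in> poly_vs.span U" for w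
      using \<phi>.span_image[of U] poly_vs.span_minimal[of "\<phi> ` U" "poly_vs.span U'"] that by auto
    \<comment> \<open>The new exceptional points are the roots of \<open>u\<close>. Elsewhere the
      image under \<phi> of a \<open>w\<close> vanishing to order \<open>Suc m\<close> vanishes to
      order \<open>m\<close>, so \<open>\<phi> w\<close> is 0 unless \<open>c\<close> is exceptional
      for \<open>U'\<close>.\<close>
    have "{c. \<exists>w\<in>poly_vs.span U. w \<noteq> 0 \<and> [:- c, 1:] ^ Suc m dvd w} \<subseteq>
      {c. \<exists>w\<in>poly_vs.span U'. w \<noteq> 0 \<and> [:- c, 1:] ^ m dvd w} \<union> {c. poly u c = 0}"
    proof (rule subsetI, rule ccontr)
      fix c assume "c \<in> {c. \<exists>w\<in>poly_vs.span U. w \<noteq> 0 \<and> [:- c, 1:] ^ Suc m dvd w}"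
      then obtain w where w: "w \<in> poly_vs.span U" "w \<noteq> 0" "[:- c, 1:] ^ Suc m dvd w" by blast
      assume "c \<notin> {c. \<exists>w\<in>poly_vs.span U'. w \<noteq> 0 \<and> [:- c, 1:] ^ m dvd w} \<union> {c. poly u c = 0}"
      then have c: "poly u c \<noteq> 0" "[:- c, 1:] ^ m dvd \<phi> w \<Longrightarrow> \<phi> w = 0"
        using span[OF w(1)] by auto
      obtain h where h: "w = [:- c, 1:] ^ Suc m * h" using w(3) by blast
      have "[:- c, 1:] ^ m dvd pderiv w"
        unfolding h pderiv_mult pderiv_power_Suc
        by (intro dvd_add dvd_mult2[OF le_imp_power_dvd]
            dvd_mult[OF dvd_mult2[OF dvd_smult[OF dvd_refl]]]) simp
      moreover have "[:- c, 1:] ^ m dvd w" using w(3) by (rule power_le_dvd) simp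
      ultimately have "\<phi> w = 0" unfolding \<phi>_def by (intro c(2)[unfolded \<phi>_def] dvd_diff dvd_mult)
      then have eq: "u * pderiv w = pderiv u * w" by (simp add: \<phi>_def)
      have "[:- c, 1:] ^ 1 dvd w" using w(3) by (rule power_le_dvd) simp
      then have ord: "order c w \<noteq> 0" 
        using w(2) poly_eq_0_iff_dvd[of w c] order_root[of w c] by simp
      have "pderiv w \<noteq> 0"
      proof
        assume "pderiv w = 0"
        then have "degree w = 0" by (simp add: pderiv_eq_0_iff)
        then obtain a where "w = [:a:]" by (metis degree_0_id)
        then show False using ord w(2) order_root[of w c] by auto
      qed
      \<comment> \<open>Comparison of orders at \<open>c\<close>: differentiation lowers the
        positive order of \<open>w\<close> by exactly one in characteristic 0 and \<open>u\<close>
        does not vanish at \<open>c\<close>, whereas the other side has order at least that of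
        \<open>w\<close>.\<close>
      then have "order c w = Suc (order c (pderiv w))" 
        using ord w(2) order_root[of w c] by (intro order_pderiv) auto
      moreover have "order c (u * pderiv w) = order c (pderiv w)"
        using c(1) \<open>pderiv w \<noteq> 0\<close> u(2) by (subst order_mult) (auto simp: order_0I)
      moreover have "order c (pderiv u * w) \<ge> order c w"
        using \<open>pderiv w \<noteq> 0\<close> u(2) eq w(2) by (subst order_mult) (auto simp flip: eq)
      ultimately show False using eq by simp
    qed
    moreover have "finite {c. poly u c = 0}" using u(2) by (rule poly_roots_finite)
    ultimately show ?thesis using fin by (meson finite_UnI finite_subset)
  qed
qed

section \<open>Complements of spaces of univariate polynomials\<close>

lemma poly_vs_card_span:
  fixes C T :: "'a::field poly set"
  assumes "poly_vs.independent C" "C \<subseteq> poly_vs.span T" "finite T" "card T \<le> card C"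
  shows "T \<subseteq> poly_vs.span C"
proof (rule ccontr)
  assume "\<not> T \<subseteq> poly_vs.span C"
  then obtain t where t: "t \<in> T" "t \<notin> poly_vs.span C" by blast
  have "poly_vs.independent (insert t C)" using t(2) assms(1) by (rule poly_vs.independent_insertI)
  moreover have "insert t C \<subseteq> poly_vs.span T" using t(1) assms(2) by (auto intro: poly_vs.span_base)
  ultimately have "finite (insert t C) \<and> card (insert t C) \<le> card T"
    using assms(3) by (intro poly_vs.independent_span_bound) auto
  moreover have "t \<notin> C" using t(2) by (auto intro: poly_vs.span_base)
  ultimately show False using assms(4) by auto
qed

lemma degree_le_in_span_monom:
  assumes "degree (p :: 'a::field poly) \<le> j"
  shows "p \<in> poly_vs.span ((\<lambda>k. monom 1 k) ` {..j})"
proof -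
  have "p = (\<Sum>k\<le>j. smult (coeff p k) (monom 1 k))"
    using poly_as_sum_of_monoms'[OF assms] by (simp add: smult_monom)
  also have "\<dots> \<in> poly_vs.span ((\<lambda>k. monom 1 k) ` {..j})"
    by (intro poly_vs.span_sum poly_vs.span_scale poly_vs.span_base) auto
  finally show ?thesis .
qed

text \<open>For \<open>m\<close> the dimension of \<open>U\<close>, reduction modulo
  \<open>[:- c, 1:] ^ m\<close> maps \<open>U\<close> to the remainders, a space of dimension
  \<open>m\<close>. Where it is injective it is bijective, and
  \<open>finite_high_order_points\<close> bounds the exceptions.\<close>

lemma generic_complement:
  fixes U :: "'a::field_char_0 poly set"
  assumes U: "poly_vs.subspace U" "\<And>p. p \<in> U \<Longrightarrow> degree p \<le> j"
  obtains m where "finite {c. \<not> ((\<forall>w\<in>U. [:- c, 1:] ^ m dvd w \<longrightarrow> w = 0) \<and>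
    (\<forall>f. \<exists>u\<in>U. [:- c, 1:] ^ m dvd f - u))}"
proof -
  obtain B where B: "B \<subseteq> U" "poly_vs.independent B" "U \<subseteq> poly_vs.span B"
    by (rule poly_vs.maximal_independent_subset)
  have UB: "poly_vs.span B = U" using B(1,3) U(1) by (rule poly_vs.span_subspace)
  have "B \<subseteq> poly_vs.span ((\<lambda>k. monom 1 k) ` {..j})"
    using B(1) U(2) degree_le_in_span_monom by blast
  then have finB: "finite B"
    using poly_vs.independent_span_bound[of "(\<lambda>k. monom (1::'a) k) ` {..j}" B] B(2) by auto
  define m where "m = card B"
  have surj: "\<exists>u\<in>U. [:- c, 1:] ^ m dvd f - u"
    if inj: "\<forall>w\<in>U. [:- c, 1:] ^ m dvd w \<longrightarrow> w = 0" for c f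
  proof -
    let ?g = "[:- c, 1:] ^ m"
    define \<phi> where "\<phi> w = w mod ?g" for w
    have lin: "Vector_Spaces.linear smult smult \<phi>"
      by unfold_locales (auto simp: \<phi>_def poly_mod_add_left mod_smult_left)
    interpret \<phi>: Vector_Spaces.linear smult smult \<phi> by (rule lin)
    have injU: "inj_on \<phi> (poly_vs.span B)"
      unfolding \<phi>.inj_on_iff_eq_0[OF poly_vs.subspace_span] using inj UB
      by (auto simp: \<phi>_def mod_eq_0_iff_dvd)
    have deg: "degree ?g = m" by (simp add: degree_linear_power)
    have in_span: "\<phi> w \<in> poly_vs.span ((\<lambda>k. monom 1 k) ` {..<m})" for w
    proof (cases "m = 0")
      case True
      then show ?thesis by (simp add: \<phi>_def)
    next
      case False
      then have "\<phi> w = 0 \<or> degree (\<phi> w) < m"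
        using degree_mod_less[of ?g w] deg unfolding \<phi>_def by auto
      then have "degree (\<phi> w) \<le> m - 1" using False by auto
      moreover have "{..m - 1} = {..<m}" using False by auto
      ultimately show ?thesis using degree_le_in_span_monom by metis
    qed
    have "(\<lambda>k. monom 1 k) ` {..<m} \<subseteq> poly_vs.span (\<phi> ` B)"
    proof (rule poly_vs_card_span)
      show "poly_vs.independent (\<phi> ` B)" using B(2) injU by (rule \<phi>.independent_injective_image)
      show "\<phi> ` B \<subseteq> poly_vs.span ((\<lambda>k. monom 1 k) ` {..<m})" using in_span by blast
      have "card (\<phi> ` B) = m" unfolding m_def
        by (rule card_image) (use injU poly_vs.span_superset inj_on_subset in blast)
      then show "card ((\<lambda>k. monom (1::'a) k) ` {..<m}) \<le> card (\<phi> ` B)"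
        using card_image_le[of "{..<m}" "\<lambda>k. monom (1::'a) k"] by simp
    qed simp
    then have "poly_vs.span ((\<lambda>k. monom 1 k) ` {..<m}) \<subseteq> \<phi> ` poly_vs.span B"
      unfolding \<phi>.span_image[symmetric] by (intro poly_vs.span_minimal) auto
    then obtain u where "u \<in> U" "\<phi> f = \<phi> u" using in_span[of f] UB by auto
    then show ?thesis by (intro bexI[of _ u]) (auto simp: \<phi>_def mod_eq_dvd_iff)
  qed
  have "{c. \<not> ((\<forall>w\<in>U. [:- c, 1:] ^ m dvd w \<longrightarrow> w = 0) \<and> (\<forall>f. \<exists>u\<in>U. [:- c, 1:] ^ m dvd f - u))} \<subseteq>
    {c. \<exists>w\<in>U. w \<noteq> 0 \<and> [:- c, 1:] ^ m dvd w}"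
    using surj by blast
  moreover have "finite {c. \<exists>w\<in>U. w \<noteq> 0 \<and> [:- c, 1:] ^ m dvd w}"
    unfolding UB[symmetric] using finB by (rule finite_high_order_points) (simp add: m_def)
  ultimately show ?thesis using that[of m] finite_subset by blast
qed

text \<open>Full rank on the quotient by \<open>N\<close>, phrased with representatives: injectivity
  or surjectivity. Exponent 0 is harmless since injectivity is then trivial.\<close>

definition lefschetz_mod :: "('a::comm_ring_1, 'n::finite) mpoly set \<Rightarrow> ('a, 'n) mpoly \<Rightarrow> bool" where
  "lefschetz_mod N a \<longleftrightarrow> (\<forall>i s.
     (\<forall>x\<in>homogeneous_part i. a ^ s * x \<in> N \<longrightarrow> x \<in> N) \<or>
     (\<forall>w\<in>homogeneous_part (i + s). \<exists>x\<in>homogeneous_part i. a ^ s * x - w \<in> N))"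

section \<open>Dehomogenisation and generic Lefschetz elements\<close>

lemma hom_pCons0: "hom_on_ring (\<lambda>a :: 'a::comm_ring_1. [:a:])"
  by (auto simp: hom_on_ring_def)

text \<open>The quotient by \<open>I\<close> as a polynomial ring in \<open>y\<close> and
  \<open>z\<close>: the variable \<open>i\<close> has coordinates \<open>a i\<close> and
  \<open>b i\<close>, and \<rho> is dehomogenisation, sending \<open>y\<close> to \<open>t\<close>
  and \<open>z\<close> to 1.\<close>

locale two_variables =
  fixes I :: "('a::field_char_0, 'n::finite) mpoly set" and y z :: "('a, 'n) mpoly"
    and a b :: "'n \<Rightarrow> 'a" and \<rho> :: "('a, 'n) mpoly \<Rightarrow> 'a poly"
  assumes ideal: "ideal.subspace I"
    and yz: "y \<in> homogeneous_part 1" "z \<in> homogeneous_part 1"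
    and Var: "\<And>i. Var i - (Const (a i) * y + Const (b i) * z) \<in> I"
    and \<rho>_def: "\<rho> = insertion (\<lambda>c. [:c:]) (\<lambda>i. [:b i, a i:])"
    and \<rho>_I: "\<And>p. p \<in> I \<Longrightarrow> \<rho> p = 0"
    and \<rho>_yz: "\<rho> y = [:0, 1:]" "\<rho> z = 1"
begin

lemma hom: "hom_on_ring \<rho>"
  unfolding \<rho>_def by (rule hom_insertion[OF hom_pCons0])

lemma \<rho>_Const: "\<rho> (Const c) = [:c:]"
  unfolding \<rho>_def by (rule insertion_Const[OF hom_pCons0])

lemma \<rho>_Var: "\<rho> (Var i) = [:b i, a i:]"
  unfolding \<rho>_def by (rule insertion_Var[OF hom_pCons0])

text \<open>Inverse to \<rho> in degree \<open>j\<close> on polynomials of degree at most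
  \<open>j\<close>; higher coefficients are dropped.\<close>

definition homogenize :: "nat \<Rightarrow> 'a poly \<Rightarrow> ('a, 'n) mpoly" where
  "homogenize j u = (\<Sum>k\<le>j. Const (coeff u k) * (y ^ k * z ^ (j - k)))"

lemma homogenize_homogeneous: "homogenize j u \<in> homogeneous_part j"
  unfolding homogenize_def
proof (intro homogeneous_sum homogeneous_scale)
  fix k assume "k \<in> {..j}"
  then show "y ^ k * z ^ (j - k) \<in> homogeneous_part j"
    using homogeneous_mult[OF homogeneous_power[OF yz(1), of k] homogeneous_power[OF yz(2), of "j - k"]]
    by simp
qed

lemma \<rho>_homogenize:
  assumes "degree u \<le> j"
  shows "\<rho> (homogenize j u) = u"
proof -
  have "\<rho> (homogenize j u) = (\<Sum>k\<le>j. \<rho> (Const (coeff u k)) * (\<rho> y ^ k * \<rho> z ^ (j - k)))"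
    using hom by (simp add: homogenize_def hom_on_ring_sum hom_on_ring_power hom_on_ring_def)
  also have "\<dots> = (\<Sum>k\<le>j. monom (coeff u k) k)"
    by (intro sum.cong refl) (simp add: \<rho>_Const \<rho>_yz monom_altdef)
  also have "\<dots> = u" using poly_as_sum_of_monoms'[OF assms] .
  finally show ?thesis .
qed

text \<open>\<open>[:q, p:]\<close> dehomogenises \<open>p y + q z\<close>. The degree bound makes
  coefficient \<open>Suc j\<close> of \<open>u\<close> vanish, so that raising the target degree
  amounts to multiplying by \<open>z\<close>.\<close>

lemma homogenize_linear_mult:
  assumes "degree u \<le> j"
  shows "homogenize (Suc j) ([:q, p:] * u) = (Const p * y + Const q * z) * homogenize j u"
proof -
  have 0: "coeff u (Suc j) = 0" using assms by (intro coeff_eq_0) simp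
  have c: "coeff ([:q, p:] * u) k = q * coeff u k + p * coeff (pCons 0 u) k" for k
    by (cases k) (auto simp: algebra_simps coeff_pCons)
  have "homogenize (Suc j) ([:q, p:] * u) =
      Const q * homogenize (Suc j) u + Const p * homogenize (Suc j) (pCons 0 u)"
    unfolding homogenize_def c
    by (simp only: Const_add Const_mult sum_distrib_left sum.distrib distrib_right mult.assoc)
  moreover have "homogenize (Suc j) u = z * homogenize j u"
  proof -
    have "homogenize (Suc j) u = (\<Sum>k\<le>j. Const (coeff u k) * (y ^ k * z ^ (Suc j - k)))"
      by (simp add: homogenize_def 0)
    also have "\<dots> = z * homogenize j u"
      unfolding homogenize_def sum_distrib_left
      by (intro sum.cong refl) (simp add: Suc_diff_le ac_simps)
    finally show ?thesis .
  qed
  moreover have "homogenize (Suc j) (pCons 0 u) = y * homogenize j u"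
    unfolding homogenize_def
    by (subst sum.atMost_Suc_shift) (simp add: sum_distrib_left ac_simps)
  ultimately show ?thesis by (simp add: algebra_simps)
qed

text \<open>By induction on forms: modulo \<open>I\<close> the variable \<open>i\<close> is
  \<open>a i y + b i z\<close>, whose effect on \<open>homogenize\<close> is known.\<close>

lemma dehomogenize:
  assumes "f \<in> homogeneous_part j"
  shows "degree (\<rho> f) \<le> j \<and> f - homogenize j (\<rho> f) \<in> I"
  using assms
proof (induction j f rule: homogeneous_induct)
  case (Const c)
  then show ?case using ideal.subspace_0[OF ideal] by (simp add: \<rho>_Const homogenize_def)
next
  case (add d f g)
  have "\<rho> (f + g) = \<rho> f + \<rho> g" using hom by (simp add: hom_on_ring_def)
  moreover have "homogenize d (u + v) = homogenize d u + homogenize d v" for u v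
    by (simp add: homogenize_def Const_add distrib_right sum.distrib)
  moreover have "(f + g) - (homogenize d (\<rho> f) + homogenize d (\<rho> g)) =
      (f - homogenize d (\<rho> f)) + (g - homogenize d (\<rho> g))" by simp
  ultimately show ?case
    using add ideal.subspace_add[OF ideal] degree_add_le by metis
next
  case (Var d f i)
  let ?l = "Const (a i) * y + Const (b i) * z"
  have r: "\<rho> (Var i * f) = [:b i, a i:] * \<rho> f" using hom \<rho>_Var by (simp add: hom_on_ring_def)
  have "degree ([:b i, a i:] * \<rho> f) \<le> degree [:b i, a i:] + degree (\<rho> f)" by (rule degree_mult_le)
  also have "\<dots> \<le> Suc d" using Var by (simp add: le_SucI)
  finally have deg: "degree (\<rho> (Var i * f)) \<le> Suc d" unfolding r .
  have "Var i * f - homogenize (Suc d) (\<rho> (Var i * f)) =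
      f * (Var i - ?l) + ?l * (f - homogenize d (\<rho> f))"
    unfolding r homogenize_linear_mult[OF conjunct1[OF Var.IH]] by (simp add: algebra_simps)
  also have "\<dots> \<in> I"
    using Var two_variables.Var[OF two_variables_axioms, of i]
    by (intro ideal.subspace_add[OF ideal] ideal.subspace_scale[OF ideal]) auto
  finally show ?case using deg by blast
qed

lemma in_I_iff:
  assumes "f \<in> homogeneous_part j"
  shows "f \<in> I \<longleftrightarrow> \<rho> f = 0"
  using dehomogenize[OF assms] \<rho>_I[of f] by (auto simp: homogenize_def)

text \<open>Multiplication by the \<open>s\<close>-th power becomes multiplication by
  \<open>[:- c, 1:] ^ s\<close>, to be compared with the exponent \<open>m j\<close> at which
  \<open>U j\<close> is complementary: it is injective if \<open>m j \<le> s\<close> and surjective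
  otherwise. Only the degrees below \<open>n0\<close> matter, so one \<open>c\<close> avoids all bad
  points.\<close>

lemma exists_lefschetz:
  assumes N: "ideal.subspace N" "I \<subseteq> N"
    and artinian: "\<And>j. j \<ge> n0 \<Longrightarrow> homogeneous_part j \<subseteq> N"
  obtains c where "lefschetz_mod N (y - Const c * z)"
proof -
  define U where "U j = \<rho> ` (N \<inter> homogeneous_part j)" for j
  have sub: "poly_vs.subspace (U j)" for j
  proof (rule poly_vs.subspaceI)
    show "0 \<in> U j" unfolding U_def
      using ideal.subspace_0[OF N(1)] hom_on_ring_zero[OF hom] by (intro image_eqI[of _ _ 0]) auto
  next
    fix p q assume "p \<in> U j" "q \<in> U j"
    then obtain p' q' where "p = \<rho> p'" "q = \<rho> q'" "p' \<in> N \<inter> homogeneous_part j"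
      "q' \<in> N \<inter> homogeneous_part j" unfolding U_def by blast
    then show "p + q \<in> U j" unfolding U_def
      using hom ideal.subspace_add[OF N(1)] homogeneous_add
      by (intro image_eqI[of _ _ "p' + q'"]) (auto simp: hom_on_ring_def)
  next
    fix c p assume "p \<in> U j"
    then obtain p' where "p = \<rho> p'" "p' \<in> N \<inter> homogeneous_part j" unfolding U_def by blast
    then show "smult c p \<in> U j" unfolding U_def
      using hom \<rho>_Const ideal.subspace_scale[OF N(1)] homogeneous_scale
      by (intro image_eqI[of _ _ "Const c * p'"]) (auto simp: hom_on_ring_def)
  qed
  have deg: "degree p \<le> j" if "p \<in> U j" for p j
    using that dehomogenize unfolding U_def by blast
  define bad where "bad j m = {c. \<not> ((\<forall>w\<in>U j. [:- c, 1:] ^ m dvd w \<longrightarrow> w = 0) \<and>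
    (\<forall>f. \<exists>u\<in>U j. [:- c, 1:] ^ m dvd f - u))}" for j m
  have "\<exists>m. finite (bad j m)" for j
    unfolding bad_def using generic_complement[OF sub deg] by blast
  then obtain m where m: "finite (bad j (m j))" for j by metis
  then have "finite (\<Union>j<n0. bad j (m j))" by simp
  then obtain c where c: "c \<notin> (\<Union>j<n0. bad j (m j))"
    using ex_new_if_finite[OF infinite_UNIV_char_0] by blast
  have c: "\<And>w. w \<in> U j \<Longrightarrow> [:- c, 1:] ^ m j dvd w \<Longrightarrow> w = 0"
      "\<And>f. \<exists>u\<in>U j. [:- c, 1:] ^ m j dvd f - u" if "j < n0" for j
  proof -
    have "c \<notin> bad j (m j)" using c that by blast
    then have "(\<forall>w\<in>U j. [:- c, 1:] ^ m j dvd w \<longrightarrow> w = 0) \<and>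
        (\<forall>f. \<exists>u\<in>U j. [:- c, 1:] ^ m j dvd f - u)"
      unfolding bad_def by blast
    then show "\<And>w. w \<in> U j \<Longrightarrow> [:- c, 1:] ^ m j dvd w \<Longrightarrow> w = 0"
      "\<And>f. \<exists>u\<in>U j. [:- c, 1:] ^ m j dvd f - u" by blast+
  qed
  define l where "l = y - Const c * z"
  have l1: "l \<in> homogeneous_part 1" unfolding l_def by (intro homogeneous_diff homogeneous_scale yz)
  have \<rho>l: "\<rho> (l ^ s * x) = [:- c, 1:] ^ s * \<rho> x" for s x
    using hom hom_on_ring_diff[OF hom, of y "Const c * z"]
    by (simp add: hom_on_ring_def hom_on_ring_power[OF hom] l_def \<rho>_yz \<rho>_Const)
  have lx: "l ^ s * x \<in> homogeneous_part (i + s)" if "x \<in> homogeneous_part i" for i s x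
    using homogeneous_mult[OF homogeneous_power[OF l1, of s] that] by (simp add: add.commute)
  have "lefschetz_mod N l"
    unfolding lefschetz_mod_def
  proof (intro allI)
    fix i s :: nat
    let ?j = "i + s"
    show "(\<forall>x\<in>homogeneous_part i. l ^ s * x \<in> N \<longrightarrow> x \<in> N) \<or>
     (\<forall>w\<in>homogeneous_part ?j. \<exists>x\<in>homogeneous_part i. l ^ s * x - w \<in> N)"
    proof (cases "?j < n0")
      case False
      \<comment> \<open>The target degree is 0 in the quotient, hence surjectivity with preimage
        0.\<close>
      have "l ^ s * 0 - w \<in> N" if "w \<in> homogeneous_part ?j" for w
      proof -
        have "w \<in> N" using artinian[of ?j] False that by auto
        then show ?thesis using ideal.subspace_neg[OF N(1)] by simp
      qed
      then show ?thesis using homogeneous_zero by blast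
    next
      case True
      note c = c[OF True]
      show ?thesis
      proof (cases "m ?j \<le> s")
        case True
        have "x \<in> N" if x: "x \<in> homogeneous_part i" "l ^ s * x \<in> N" for x
        proof -
          have "\<rho> (l ^ s * x) \<in> U ?j" unfolding U_def using x lx by blast
          moreover have "[:- c, 1:] ^ m ?j dvd \<rho> (l ^ s * x)"
            unfolding \<rho>l using True by (intro dvd_mult2 le_imp_power_dvd)
          ultimately have "\<rho> (l ^ s * x) = 0" by (rule c(1))
          then have "\<rho> x = 0" unfolding \<rho>l by simp
          then show ?thesis using in_I_iff[OF x(1)] N(2) by auto
        qed
        then show ?thesis by blast
      next
        case False
        \<comment> \<open>Complementarity corrects \<open>w\<close> by some \<open>n\<close> in
          \<open>N\<close> so that \<open>[:- c, 1:] ^ s\<close> divides the dehomogenised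
          difference; the quotient \<open>q\<close> has degree at most \<open>i\<close>, and
          homogenising it gives the preimage.\<close>
        have "\<exists>x\<in>homogeneous_part i. l ^ s * x - w \<in> N" if w: "w \<in> homogeneous_part ?j" for w
        proof -
          obtain u where u: "u \<in> U ?j" "[:- c, 1:] ^ m ?j dvd \<rho> w - u" using c(2) by blast
          then obtain n where n: "n \<in> N" "n \<in> homogeneous_part ?j" "u = \<rho> n" unfolding U_def by blast
          have "[:- c, 1:] ^ s dvd \<rho> w - u" using u(2) False by (meson dvd_trans le_imp_power_dvd nat_le_linear)
          then obtain q where q: "\<rho> w - u = [:- c, 1:] ^ s * q" by blast
          have "degree q \<le> i"
          proof (cases "q = 0")
            case False
            have "degree (\<rho> w - u) = s + degree q"
              unfolding q using False by (subst degree_mult_eq) (auto simp: degree_linear_power)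
            moreover have "degree (\<rho> w - u) \<le> i + s"
              using dehomogenize[OF w] deg[OF u(1)] by (intro degree_diff_le) auto
            ultimately show ?thesis by simp
          qed simp
          then have qx: "\<rho> (homogenize i q) = q" by (rule \<rho>_homogenize)
          have hx: "homogenize i q \<in> homogeneous_part i" by (rule homogenize_homogeneous)
          let ?d = "l ^ s * homogenize i q - w + n"
          have "?d \<in> homogeneous_part ?j"
            by (intro homogeneous_add homogeneous_diff lx hx w n(2))
          moreover have "\<rho> ?d = \<rho> (l ^ s * homogenize i q) - \<rho> w + \<rho> n"
            using hom hom_on_ring_diff[OF hom, of _ w] unfolding hom_on_ring_def by metis
          then have "\<rho> ?d = 0" unfolding \<rho>l qx q[symmetric] n(3) by simp
          ultimately have "?d \<in> N" using in_I_iff N(2) by blast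
          then have "?d - n \<in> N" using n(1) by (rule ideal.subspace_diff[OF N(1)])
          then show ?thesis using hx by (intro bexI[of _ "homogenize i q"]) auto
        qed
        then show ?thesis by blast
      qed
    qed
  qed
  then show ?thesis using that[of c] by (simp add: l_def)
qed

end

text \<open>Each variable is a multiple of \<open>z\<close> modulo \<open>N\<close>, so degree
  \<open>j\<close> of the quotient is spanned by \<open>z ^ j\<close> and every power of
  \<open>z\<close> acts surjectively.\<close>

lemma lefschetz_mod_power_generator:
  fixes z :: "('a::comm_ring_1, 'n::finite) mpoly"
  assumes N: "ideal.subspace N" and z: "z \<in> homogeneous_part 1"
    and Var: "\<And>i. Var i - Const (\<kappa> i) * z \<in> N"
  shows "lefschetz_mod N z"
proof -
  have *: "\<exists>k. f - Const k * z ^ j \<in> N" if "f \<in> homogeneous_part j" for f j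
    using that
  proof (induction j f rule: homogeneous_induct)
    case (Const c)
    then show ?case using ideal.subspace_0[OF N] by (intro exI[of _ c]) simp
  next
    case (add d f g)
    then obtain k k' where "f - Const k * z ^ d \<in> N" "g - Const k' * z ^ d \<in> N" by blast
    then have "(f - Const k * z ^ d) + (g - Const k' * z ^ d) \<in> N" by (rule ideal.subspace_add[OF N])
    then show ?case by (intro exI[of _ "k + k'"]) (simp add: Const_add algebra_simps)
  next
    case (Var d f i)
    then obtain k where k: "f - Const k * z ^ d \<in> N" by blast
    have "Var i * f - Const (\<kappa> i * k) * z ^ Suc d =
        f * (Var i - Const (\<kappa> i) * z) + (Const (\<kappa> i) * z) * (f - Const k * z ^ d)"
      by (simp add: Const_mult algebra_simps)
    also have "\<dots> \<in> N"
      by (intro ideal.subspace_add[OF N] ideal.subspace_scale[OF N] k assms(3))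
    finally show ?case by blast
  qed
  have "\<exists>x\<in>homogeneous_part i. z ^ s * x - w \<in> N" if "w \<in> homogeneous_part (i + s)" for w i s
  proof -
    obtain k where k: "w - Const k * z ^ (i + s) \<in> N" using *[OF \<open>w \<in> _\<close>] by blast
    have "Const k * z ^ i \<in> homogeneous_part i" by (intro homogeneous_scale homogeneous_power z)
    moreover have "z ^ s * (Const k * z ^ i) - w = - (w - Const k * z ^ (i + s))"
      by (simp add: power_add algebra_simps)
    then have "z ^ s * (Const k * z ^ i) - w \<in> N" using ideal.subspace_neg[OF N k] by metis
    ultimately show ?thesis by blast
  qed
  then show ?thesis unfolding lefschetz_mod_def by blast
qed


section \<open>Generic linear forms\<close>

abbreviation dot :: "'a::comm_ring_1 ^ 'n::finite \<Rightarrow> 'a ^ 'n \<Rightarrow> 'a" where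
  "dot x v \<equiv> (\<Sum>i\<in>UNIV. x $ i * v $ i)"

text \<open>The moment curve \<open>t \<mapsto> (1, t, t\<^sup>2, \<dots>)\<close> meets a hyperplane in finitely many points.\<close>

lemma exists_nonvanishing_vector:
  fixes V :: "('a::field_char_0 ^ 'n::finite) set"
  assumes "finite V" "0 \<notin> V"
  obtains w :: "'a ^ 'n" where "\<And>v. v \<in> V \<Longrightarrow> dot v w \<noteq> 0"
proof -
  obtain k :: "'n \<Rightarrow> nat" where k: "inj k"
    using finite_imp_inj_to_nat_seg[of "UNIV :: 'n set"] by auto
  \<comment> \<open>\<open>P v\<close> is the pairing of \<open>v\<close> with the curve. The
    exponents \<open>k\<close> are distinct, though not necessarily consecutive, so
    \<open>P v\<close> has the entries of \<open>v\<close> as coefficients.\<close>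
  define P where "P v = (\<Sum>i\<in>UNIV. monom (v $ i) (k i))" for v :: "'a ^ 'n"
  have "coeff (P v) (k j) = v $ j" for v j
  proof -
    have "coeff (P v) (k j) = (\<Sum>i\<in>UNIV. if i = j then v $ j else 0)"
      unfolding P_def coeff_sum using k by (intro sum.cong refl) (auto dest: injD)
    then show ?thesis by simp
  qed
  then have "P v \<noteq> 0" if "v \<noteq> 0" for v using that by (metis coeff_0 vec_eq_iff zero_index)
  then have "finite {t. poly (P v) t = 0}" if "v \<in> V" for v
    using that assms(2) poly_roots_finite by metis
  then have "finite (\<Union>v\<in>V. {t. poly (P v) t = 0})" using assms(1) by blast
  then obtain t where t: "t \<notin> (\<Union>v\<in>V. {t. poly (P v) t = 0})"
    using ex_new_if_finite[OF infinite_UNIV_char_0] by blast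
  have "dot v (\<chi> i. t ^ k i) = poly (P v) t" for v
    by (simp add: P_def poly_sum poly_monom)
  then show ?thesis using t that[of "\<chi> i. t ^ k i"] by auto
qed

lemma dot_eq_0_span:
  fixes v :: "'a::field ^ 'n::finite"
  assumes "x \<in> vec.span F" "\<And>x. x \<in> F \<Longrightarrow> dot x v = 0"
  shows "dot x v = 0"
  using assms(1)
proof (induction rule: vec.span_induct_alt)
  case (step k x y)
  have "dot (k *s x + y) v = k * dot x v + dot y v"
    by (simp add: distrib_right sum.distrib sum_distrib_left mult.assoc)
  then show ?case using step assms(2) by simp
qed simp

text \<open>Each proper span lies in a hyperplane with nonzero normal vector, and a vector on which
  none of these finitely many normals vanishes is outside all of them.\<close>

lemma avoid_proper_subspaces:
  fixes \<F> :: "('a::field_char_0 ^ 'n::finite) set set"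
  assumes "finite \<F>" "\<And>F. F \<in> \<F> \<Longrightarrow> vec.span F \<noteq> UNIV"
  obtains c where "\<And>F. F \<in> \<F> \<Longrightarrow> c \<notin> vec.span F"
proof -
  have "\<exists>v :: 'a ^ 'n. v \<noteq> 0 \<and> (\<forall>x\<in>F. dot x v = 0)" if F: "F \<in> \<F>" for F
  proof -
    obtain c where c: "c \<notin> vec.span F" using assms(2)[OF F] by auto
    obtain v :: "'a ^ 'n" where v: "\<And>x. x \<in> F \<Longrightarrow> dot x v = 0" "dot c v = 1"
      using exists_separating_vector[OF c] by blast
    then have "v \<noteq> 0" by auto
    then show ?thesis using v(1) by blast
  qed
  then obtain v :: "('a ^ 'n) set \<Rightarrow> 'a ^ 'n"
    where v: "\<And>F. F \<in> \<F> \<Longrightarrow> v F \<noteq> 0" "\<And>F x. F \<in> \<F> \<Longrightarrow> x \<in> F \<Longrightarrow> dot x (v F) = 0"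
    by metis
  have "0 \<notin> v ` \<F>" using v(1) by force
  then obtain w :: "'a ^ 'n" where "\<And>x. x \<in> v ` \<F> \<Longrightarrow> dot x w \<noteq> 0"
    using exists_nonvanishing_vector[OF finite_imageI[OF assms(1)]] by metis
  then have w: "\<And>F. F \<in> \<F> \<Longrightarrow> dot (v F) w \<noteq> 0" by blast
  have "w \<notin> vec.span F" if F: "F \<in> \<F>" for F
  proof
    assume "w \<in> vec.span F"
    then have "dot w (v F) = 0" using v(2)[OF F] by (rule dot_eq_0_span)
    then show False using w[OF F] by (simp add: mult.commute)
  qed
  then show ?thesis using that by blast
qed

text \<open>The vectors are chosen one after the other: the subspaces to avoid are spanned by fewer
  than \<open>CARD('n)\<close> vectors, hence proper, and finite in number.\<close>

lemma exists_generic_vectors: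
  fixes \<F> :: "('a::field_char_0 ^ 'n::finite) set set"
  assumes "finite \<F>" "\<And>F. F \<in> \<F> \<Longrightarrow> finite F"
  obtains c :: "nat \<Rightarrow> 'a ^ 'n" where
    "\<And>k F. F \<in> \<F> \<Longrightarrow> k + card F < CARD('n) \<Longrightarrow> c k \<notin> vec.span (c ` {..<k} \<union> F)"
proof -
  have "\<exists>c :: nat \<Rightarrow> 'a ^ 'n. \<forall>k<n. \<forall>F\<in>\<F>. k + card F < CARD('n) \<longrightarrow> c k \<notin> vec.span (c ` {..<k} \<union> F)"
    for n
  proof (induction n)
    case (Suc n)
    then obtain c :: "nat \<Rightarrow> 'a ^ 'n" where
      c: "\<forall>k<n. \<forall>F\<in>\<F>. k + card F < CARD('n) \<longrightarrow> c k \<notin> vec.span (c ` {..<k} \<union> F)" by blast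
    let ?\<G> = "(\<lambda>F. c ` {..<n} \<union> F) ` {F \<in> \<F>. n + card F < CARD('n)}"
    have "vec.span G \<noteq> UNIV" if G: "G \<in> ?\<G>" for G
    proof
      assume *: "vec.span G = UNIV"
      obtain F where F: "F \<in> \<F>" "n + card F < CARD('n)" "G = c ` {..<n} \<union> F" using G by blast
      have "CARD('n) = vec.dim (vec.span G)" unfolding * vec_dim_card ..
      also have "\<dots> \<le> card G" using F assms(2) by (intro vec.dim_le_card) auto
      also have "\<dots> \<le> card (c ` {..<n}) + card F" unfolding F(3) by (rule card_Un_le)
      also have "\<dots> \<le> n + card F" using card_image_le[of "{..<n}" c] by simp
      finally show False using F(2) by simp
    qed
    then obtain x where x: "\<And>G. G \<in> ?\<G> \<Longrightarrow> x \<notin> vec.span G"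
      using avoid_proper_subspaces[of ?\<G>] assms(1) by auto
    define c' where "c' = c(n := x)"
    have im: "c' ` {..<k} = c ` {..<k}" if "k \<le> n" for k
      using that unfolding c'_def by (intro image_cong) auto
    have "c' k \<notin> vec.span (c' ` {..<k} \<union> F)" if "k < Suc n" "F \<in> \<F>" "k + card F < CARD('n)" for k F
    proof (cases "k = n")
      case True
      then show ?thesis using x that im[of n] by (auto simp: c'_def)
    next
      case False
      then show ?thesis using c that im[of k] by (auto simp: c'_def)
    qed
    then show ?case by blast
  qed simp
  then obtain c :: "nat \<Rightarrow> 'a ^ 'n" where
    "\<forall>k<CARD('n). \<forall>F\<in>\<F>. k + card F < CARD('n) \<longrightarrow> c k \<notin> vec.span (c ` {..<k} \<union> F)" by blast
  then show ?thesis using that[of c] by auto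
qed

section \<open>Independence and dimension counts\<close>

lemma generic_vectors_independent:
  fixes c :: "nat \<Rightarrow> 'a::field ^ 'n::finite"
  assumes "\<And>j. j < k \<Longrightarrow> c j \<notin> vec.span (c ` {..<j} \<union> F)" "vec.independent F"
  shows "vec.independent (c ` {..<k} \<union> F) \<and> card (c ` {..<k} \<union> F) = k + card F"
  using assms(1)
proof (induction k)
  case (Suc k)
  let ?S = "c ` {..<k} \<union> F"
  have ck: "c k \<notin> vec.span ?S" using Suc.prems by blast
  then have "c k \<notin> ?S" using vec.span_base[of "c k" ?S] by metis
  moreover have "finite ?S" using vec.finiteI_independent[OF assms(2)] by simp
  moreover have "c ` {..<Suc k} \<union> F = insert (c k) ?S" by (auto simp: less_Suc_eq)
  ultimately show ?case using Suc ck vec.independent_insertI[OF ck] by simp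
qed (use assms(2) in simp)

lemma independent_insert_card:
  fixes S :: "('a::field ^ 'n::finite) set"
  assumes "vec.independent (insert x S)" "finite S" "card S < card (insert x S)"
  shows "x \<notin> vec.span S"
proof -
  have "x \<notin> S" using assms(3) by (metis insert_absorb less_irrefl)
  then show ?thesis using assms(1) by (auto simp: vec.independent_insert)
qed

lemma independent_card_spans:
  fixes S :: "('a::field ^ 'n::finite) set"
  assumes "vec.independent S" "card S = CARD('n)"
  shows "vec.span S = UNIV"
proof -
  have "vec.dim (UNIV :: ('a ^ 'n) set) \<le> card S" unfolding vec_dim_card assms(2) by simp
  then have "UNIV \<subseteq> vec.span S" using assms(1) by (intro vec.card_ge_dim_independent) auto
  then show ?thesis by blast
qed

section \<open>Ideals containing all forms of some degree\<close>

lemma lin_span: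
  fixes x :: "'a::field ^ 'n::finite"
  assumes "x \<in> vec.span S"
  shows "lin x \<in> ideal.span (lin ` S)"
  using assms
proof (induction rule: vec.span_induct_alt)
  case base
  then show ?case by (simp add: ideal.span_zero)
next
  case (step k x y)
  have "lin x \<in> ideal.span (lin ` S)" using step(1) by (intro ideal.span_base imageI)
  then show ?case unfolding lin_add lin_scale
    using step by (intro ideal.span_add ideal.span_scale)
qed

text \<open>Every monomial of degree \<open>d + e\<close> splits into monomials of degrees
  \<open>d\<close> and \<open>e\<close>.\<close>

lemma homogeneous_add_subset:
  fixes N :: "('a::comm_ring_1, 'n::finite) mpoly set"
  assumes N: "ideal.subspace N"
    and prod: "\<And>g h. g \<in> homogeneous_part d \<Longrightarrow> h \<in> homogeneous_part e \<Longrightarrow> g * h \<in> N"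
  shows "homogeneous_part (d + e) \<subseteq> N"
proof
  have split: "\<exists>m1 m2. m = m1 + m2 \<and> mdeg m1 = d \<and> mdeg m2 = e" if "mdeg m = d + e" for m :: "'n \<Rightarrow>\<^sub>0 nat"
    using that
  proof (induction d arbitrary: m)
    case 0
    then show ?case by (intro exI[of _ 0] exI[of _ m]) simp
  next
    case (Suc d)
    then have "mdeg m = Suc (d + e)" by simp
    then obtain i m' where m: "m = Poly_Mapping.single i 1 + m'" "mdeg m' = d + e"
      by (rule mdeg_Suc_split)
    then obtain m1 m2 where "m' = m1 + m2" "mdeg m1 = d" "mdeg m2 = e" using Suc.IH by blast
    then show ?case using m(1)
      by (intro exI[of _ "Poly_Mapping.single i 1 + m1"] exI[of _ m2]) (simp add: mdeg_add add.assoc)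
  qed
  fix f :: "('a, 'n) mpoly" assume f: "f \<in> homogeneous_part (d + e)"
  have "(\<Sum>m\<in>Poly_Mapping.keys f. Poly_Mapping.single m (Poly_Mapping.lookup f m)) \<in> N"
  proof (rule ideal.subspace_sum[OF N])
    fix m assume "m \<in> Poly_Mapping.keys f"
    then have "mdeg m = d + e" using f by (simp add: homogeneous_part_alt)
    then obtain m1 m2 where m: "m = m1 + m2" "mdeg m1 = d" "mdeg m2 = e" using split by blast
    have "Poly_Mapping.single m (Poly_Mapping.lookup f m) =
        Poly_Mapping.single m1 1 * Poly_Mapping.single m2 (Poly_Mapping.lookup f m)"
      by (simp add: mult_single m(1))
    also have "\<dots> \<in> N" by (intro prod homogeneous_single m)
    finally show "Poly_Mapping.single m (Poly_Mapping.lookup f m) \<in> N" .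
  qed
  then show "f \<in> N" using mpoly_sum_monomials[of f] by simp
qed

text \<open>Rests on the inclusion of \<open>(a, Y) (b, Y)\<close> in
  \<open>(a b, Y)\<close>.\<close>

lemma homogeneous_subset_mult:
  fixes a b :: "('a::comm_ring_1, 'n::finite) mpoly"
  assumes "homogeneous_part d \<subseteq> ideal.span (insert a Y)"
    and "homogeneous_part e \<subseteq> ideal.span (insert b Y)"
  shows "homogeneous_part (d + e) \<subseteq> ideal.span (insert (a * b) Y)"
proof (rule homogeneous_add_subset)
  fix g h :: "('a, 'n) mpoly" assume "g \<in> homogeneous_part d" "h \<in> homogeneous_part e"
  then have "g \<in> ideal.span (insert a Y)" "h \<in> ideal.span (insert b Y)" using assms by auto
  obtain k x where g: "g = k * a + x" "x \<in> ideal.span Y" using \<open>g \<in> ideal.span _\<close> by (rule ideal_span_insertE)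
  obtain k' x' where h: "h = k' * b + x'" "x' \<in> ideal.span Y" using \<open>h \<in> ideal.span _\<close> by (rule ideal_span_insertE)
  have "g * h = (k * k') * (a * b) + ((k * a) * x' + h * x)"
    unfolding g(1) h(1) by (simp add: algebra_simps)
  also have "\<dots> \<in> ideal.span (insert (a * b) Y)"
    by (intro ideal_span_insertI ideal.span_add ideal.span_scale g h)
  finally show "g * h \<in> ideal.span (insert (a * b) Y)" .
qed simp

lemma homogeneous_subset_prod:
  fixes f :: "'h \<Rightarrow> ('a::comm_ring_1, 'n::finite) mpoly"
  assumes "finite T" "\<And>x. x \<in> T \<Longrightarrow> homogeneous_part d \<subseteq> ideal.span (insert (f x) Y)"
  shows "homogeneous_part (card T * d) \<subseteq> ideal.span (insert (\<Prod>x\<in>T. f x) Y)"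
  using assms
proof (induction T)
  case empty
  have "p * 1 \<in> ideal.span (insert 1 Y)" for p :: "('a, 'n) mpoly"
    by (intro ideal.span_scale ideal.span_base) simp
  then show ?case by auto
next
  case (insert x T)
  then show ?case using homogeneous_subset_mult[of d "f x" Y "card T * d" "\<Prod>x\<in>T. f x"] by simp
qed

lemma nzd_mod_lefschetz: 
  assumes "nzd_mod a N"
  shows "lefschetz_mod N a"
proof -
  have "x \<in> N" if "a ^ s * x \<in> N" for s x
    using that
  proof (induction s)
    case (Suc s)
    then show ?case using assms unfolding nzd_mod_def by (simp add: mult.assoc)
  qed simp
  then show ?thesis unfolding lefschetz_mod_def by blast
qed

section \<open>The generic sequence of an arrangement\<close>

locale arrangement_forms =
  fixes A :: "'h set" and v :: "'h \<Rightarrow> 'a::field_char_0 ^ 'n::finite"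
  assumes fin: "finite A" and nz: "\<And>H. H \<in> A \<Longrightarrow> v H \<noteq> 0"
    and indep: "\<And>H K. H \<in> A \<Longrightarrow> K \<in> A \<Longrightarrow> H \<noteq> K \<Longrightarrow> v H \<notin> vec.span {v K}"
begin

definition Q :: "('a, 'n) mpoly" where "Q = (\<Prod>H\<in>A. lin (v H))"

lemma indep2:
  assumes "H \<in> A" "K \<in> A" "H \<noteq> K"
  shows "vec.independent {v H, v K}" "card {v H, v K} = 2"
proof -
  have "vec.independent {v K}" using nz[OF assms(2)] by simp
  then show "vec.independent {v H, v K}" using indep[OF assms] by (rule vec.independent_insertI[rotated])
  have "v H \<noteq> v K" using indep[OF assms] vec.span_base[of "v K" "{v K}"] by auto
  then show "card {v H, v K} = 2" by simp
qed

end

text \<open>The bound in \<open>c2\<close> leaves room for two defining forms beside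
  \<open>c 0, ..., c k\<close>. The case \<open>H = K\<close> is included and gives independence
  from a single form.\<close>

locale generic_forms = arrangement_forms A v
  for A :: "'h set" and v :: "'h \<Rightarrow> 'a::field_char_0 ^ 'n::finite" +
  fixes c :: "nat \<Rightarrow> 'a ^ 'n" and w :: "'a ^ 'n"
  assumes c: "\<And>k. k < CARD('n) \<Longrightarrow> c k \<notin> vec.span (c ` {..<k})"
    and c2: "\<And>k H K. k + 2 < CARD('n) \<Longrightarrow> H \<in> A \<Longrightarrow> K \<in> A \<Longrightarrow>
      c k \<notin> vec.span (c ` {..<k} \<union> {v H, v K})"
    and w: "\<And>H. H \<in> A \<Longrightarrow> dot (v H) w \<noteq> 0"
begin

lemma indep_c:
  assumes "k \<le> CARD('n)"
  shows "vec.independent (c ` {..<k}) \<and> card (c ` {..<k}) = k"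
  using generic_vectors_independent[of k c "{}", OF _ vec.independent_empty] c assms by simp

lemma indep_c1:
  assumes "k + 2 \<le> CARD('n)" "H \<in> A"
  shows "vec.independent (insert (v H) (c ` {..<k})) \<and> card (insert (v H) (c ` {..<k})) = k + 1"
proof -
  have "c j \<notin> vec.span (c ` {..<j} \<union> {v H})" if "j < k" for j
    using c2[of j H H] that assms by simp
  then show ?thesis using generic_vectors_independent[of k c "{v H}"] nz[OF assms(2)] by simp
qed

lemma indep_c2:
  assumes "k + 2 \<le> CARD('n)" "H \<in> A" "K \<in> A" "H \<noteq> K"
  shows "vec.independent (insert (v K) (insert (v H) (c ` {..<k}))) \<and>
    card (insert (v K) (insert (v H) (c ` {..<k}))) = k + 2"
proof -
  have "c j \<notin> vec.span (c ` {..<j} \<union> {v H, v K})" if "j < k" for j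
    using c2[of j H K] that assms by simp
  then have "vec.independent (c ` {..<k} \<union> {v H, v K}) \<and>
      card (c ` {..<k} \<union> {v H, v K}) = k + card {v H, v K}"
    by (intro generic_vectors_independent indep2 assms) auto
  moreover have "c ` {..<k} \<union> {v H, v K} = insert (v K) (insert (v H) (c ` {..<k}))" by blast
  ultimately show ?thesis using indep2(2)[OF assms(2-4)] by simp
qed

lemma coprime_forms:
  assumes k: "k + 2 \<le> CARD('n)"
  shows "coprime_forms A (\<lambda>H. lin (v H)) (lin ` c ` {..<k})"
proof
  show "finite A" by (rule fin)
  show "lin_prime (ideal.span (lin ` c ` {..<k}))"
    using indep_c[of k] k by (intro lin_prime_independent) auto
  have cle: "card (c ` {..<k}) \<le> k" using card_image_le[of "{..<k}" c] by simp
  fix H assume H: "H \<in> A"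
  show "lin_prime (ideal.span (insert (lin (v H)) (lin ` c ` {..<k})))"
    using indep_c1[OF k H] lin_prime_independent[of "insert (v H) (c ` {..<k})"] by simp
  have "v H \<notin> vec.span (c ` {..<k})"
    using indep_c1[OF k H] cle by (intro independent_insert_card) auto
  then show "lin (v H) \<notin> ideal.span (lin ` c ` {..<k})" by (rule lin_notin_ideal)
  fix K assume K: "K \<in> A" "H \<noteq> K"
  have "v K \<notin> vec.span (insert (v H) (c ` {..<k}))"
    using indep_c2[OF k H K] indep_c1[OF k H] by (intro independent_insert_card) auto
  then show "lin (v K) \<notin> ideal.span (insert (lin (v H)) (lin ` c ` {..<k}))"
    using lin_notin_ideal[of "v K" "insert (v H) (c ` {..<k})"] by simp
qed

text \<open>The derivative in direction \<open>w\<close>; as \<open>w\<close> is outside all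
  hyperplanes, each defining form is sent to a nonzero constant.\<close>

definition \<theta> :: "('a, 'n) mpoly \<Rightarrow> ('a, 'n) mpoly" where
  "\<theta> = der_of (\<lambda>i. Const (w $ i))"

lemma \<theta>_der: "\<theta> \<in> derivations"
  by (simp add: \<theta>_def)

lemma \<theta>_lin: "\<theta> (lin x) = Const (dot x w)"
  unfolding \<theta>_def der_of_def partial_lin
  by (simp add: hom_on_ring_sum[OF hom_Const] Const_mult mult.commute)

lemma \<theta>_notin:
  assumes "H \<in> A" "lin_prime P" "ideal.subspace P"
  shows "\<theta> (lin (v H)) \<notin> P"
proof
  assume "\<theta> (lin (v H)) \<in> P"
  then have "Const (inverse (dot (v H) w)) * Const (dot (v H) w) \<in> P"
    unfolding \<theta>_lin by (rule ideal.subspace_scale[OF assms(3)])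
  moreover have "Const (inverse (dot (v H) w)) * (Const (dot (v H) w) :: ('a, 'n) mpoly) = 1"
    using Const_inverse[OF w[OF assms(1)]] by (simp only: mult.commute)
  ultimately have "1 \<in> P" by metis
  then show False using lin_prime_one_notin[OF assms(2)] by simp
qed

text \<open>The range of \<open>k\<close> is dictated by \<open>coprime_forms\<close>, which is
  applied to \<open>k + 1\<close> generic forms: on their common zeros the defining forms must still
  be pairwise non-proportional.\<close>

lemma regular:
  assumes B: "der.independent B"
    and D: "der.span B = {\<delta> \<in> derivations. \<forall>H\<in>A. lin (v H) dvd \<delta> (lin (v H))}"
    and k: "k + 2 < CARD('n)"
  shows "nzd_mod (lin (c k)) (ideal.span (lin ` c ` {..<k} \<union> jac_gens Q))"
proof -
  \<comment> \<open>\<open>{..<0}\<close> is empty: this instance has no generic forms and turns the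
    condition on single forms into one on \<open>Q\<close>.\<close>
  interpret C0: coprime_forms A "\<lambda>H. lin (v H)" "lin ` c ` {..<0}"
    using k by (intro coprime_forms) simp
  have "der.span B = {\<delta> \<in> derivations. Q dvd \<delta> Q}"
    unfolding D Q_def using C0.log_derivation_iff by auto
  moreover have "nzd_mod (lin (c j)) (ideal.span ((\<lambda>j. lin (c j)) ` {..<j}))" if "j < CARD('n) - 2" for j
  proof -
    have "lin (c j) \<notin> ideal.span (lin ` c ` {..<j})" using c[of j] that by (intro lin_notin_ideal) simp
    moreover have "lin_prime (ideal.span (lin ` c ` {..<j}))"
      using indep_c[of j] that by (intro lin_prime_independent) auto
    ultimately show ?thesis by (simp add: nzd_mod_lin_prime image_image)
  qed
  moreover have "nzd_mod Q (ideal.span ((\<lambda>j. lin (c j)) ` {..j})) \<and>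
      nzd_mod (\<theta> Q) (ideal.span (insert Q ((\<lambda>j. lin (c j)) ` {..j})))" if "j < CARD('n) - 2" for j
  proof -
    interpret C: coprime_forms A "\<lambda>H. lin (v H)" "lin ` c ` {..<Suc j}"
      using that by (intro coprime_forms) simp
    have "\<theta> (lin (v H)) \<notin> ideal.span (insert (lin (v H)) (lin ` c ` {..<Suc j}))" if "H \<in> A" for H
      by (intro \<theta>_notin that C.prime ideal.subspace_span)
    then show ?thesis
      using C.nzd_prod C.nzd_derivation_prod[OF \<theta>_der]
      by (simp add: Q_def image_image lessThan_Suc_atMost)
  qed
  ultimately have "nzd_mod (lin (c k)) (ideal.span ((\<lambda>j. lin (c j)) ` {..<k} \<union> jac_gens Q))"
    using k by (intro nzd_mod_jacobian[OF B _ \<theta>_der, of Q "CARD('n) - 2"]) auto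
  then show ?thesis by (simp add: image_image)
qed

text \<open>Modulo the generic forms any two defining forms generate all linear forms. So all forms
  of degree \<open>card A - 1\<close> lie in the ideal of \<open>lin (v H)\<close> and the product
  of the others, which modulo \<open>lin (v H)\<close> is \<open>\<theta> Q\<close> up to a unit.
  Multiplying over all \<open>H\<close> replaces \<open>lin (v H)\<close> by
  \<open>Q\<close>.\<close>

lemma artinian:
  assumes "2 \<le> CARD('n)"
  obtains n0 where "\<And>j. n0 \<le> j \<Longrightarrow>
    homogeneous_part j \<subseteq> ideal.span (lin ` c ` {..<CARD('n) - 2} \<union> jac_gens Q)"
proof -
  let ?k = "CARD('n) - 2" and ?N = "ideal.span (lin ` c ` {..<CARD('n) - 2} \<union> jac_gens Q)"
  have k: "?k + 2 = CARD('n)" using assms by simp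
  let ?Y = "lin ` c ` {..<?k}"
  interpret C: coprime_forms A "\<lambda>H. lin (v H)" ?Y using k by (intro coprime_forms) simp
  have two: "homogeneous_part 1 \<subseteq> ideal.span (insert (lin (v K)) (insert (lin (v H)) ?Y))"
    if "H \<in> A" "K \<in> A" "H \<noteq> K" for H K
  proof
    fix p :: "('a, 'n) mpoly" assume "p \<in> homogeneous_part 1"
    then obtain x where p: "p = lin x" by (rule homogeneous_1_lin)
    have "vec.span (insert (v K) (insert (v H) (c ` {..<?k}))) = UNIV"
      using indep_c2[of ?k H K] that k by (intro independent_card_spans) auto
    then have "lin x \<in> ideal.span (lin ` insert (v K) (insert (v H) (c ` {..<?k})))"
      by (intro lin_span) simp
    then show "p \<in> ideal.span (insert (lin (v K)) (insert (lin (v H)) ?Y))" by (simp add: p)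
  qed
  let ?d = "card A - 1"
  have one: "homogeneous_part ?d \<subseteq> ideal.span (insert (lin (v H)) (insert (\<theta> Q) ?Y))" if H: "H \<in> A" for H
  proof -
    let ?P = "\<Prod>K\<in>A - {H}. lin (v K) :: ('a, 'n) mpoly"
    let ?J = "ideal.span (insert (lin (v H)) (insert (\<theta> Q) ?Y))"
    have "homogeneous_part (card (A - {H}) * 1) \<subseteq> ideal.span (insert ?P (insert (lin (v H)) ?Y))"
      using fin two H by (intro homogeneous_subset_prod) auto
    then have "homogeneous_part ?d \<subseteq> ideal.span (insert ?P (insert (lin (v H)) ?Y))"
      using fin H by simp
    also have "\<dots> \<subseteq> ?J"
    proof (rule ideal.span_minimal)
      obtain m where m: "\<theta> Q = m * lin (v H) + \<theta> (lin (v H)) * ?P"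
        using C.derivation_prod_mod[OF \<theta>_der H] unfolding Q_def by blast
      define s where "s = inverse (dot (v H) w)"
      have inv: "Const s * (Const (dot (v H) w) :: ('a, 'n) mpoly) = 1"
        unfolding s_def using Const_inverse[OF w[OF H]] by (simp only: mult.commute)
      have "Const s * (\<theta> Q - m * lin (v H)) = (Const s * Const (dot (v H) w)) * ?P"
        unfolding m \<theta>_lin by (simp add: mult.assoc)
      then have "?P = Const s * (\<theta> Q - m * lin (v H))" unfolding inv by simp
      also have "\<dots> \<in> ?J"
        by (intro ideal.span_scale ideal.span_diff ideal.span_base) auto
      finally show "insert ?P (insert (lin (v H)) ?Y) \<subseteq> ?J"
        by (auto intro: ideal.span_base)
    qed simp
    finally show ?thesis .
  qed
  let ?n0 = "card A * ?d"
  have "homogeneous_part ?n0 \<subseteq> ideal.span (insert Q (insert (\<theta> Q) ?Y))"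
    unfolding Q_def using fin one unfolding Q_def by (intro homogeneous_subset_prod)
  also have "\<dots> \<subseteq> ?N"
  proof (rule ideal.span_minimal)
    have "\<theta> Q \<in> ?N" unfolding \<theta>_def der_of_def
      by (intro ideal.span_sum ideal.span_scale ideal.span_base) auto
    then show "insert Q (insert (\<theta> Q) ?Y) \<subseteq> ?N" by (auto intro: ideal.span_base)
  qed simp
  finally have n0: "homogeneous_part ?n0 \<subseteq> ?N" .
  have "homogeneous_part (?n0 + e) \<subseteq> ?N" for e
  proof (rule homogeneous_add_subset)
    fix g h :: "('a, 'n) mpoly" assume "g \<in> homogeneous_part ?n0"
    then have "h * g \<in> ?N" using n0 by (intro ideal.span_scale) auto
    then show "g * h \<in> ?N" by (simp only: mult.commute)
  qed simp
  then show ?thesis using that[of ?n0] by (metis le_Suc_ex)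
qed

section \<open>Coordinates along the basis \<open>c\<close>\<close>

lemma basis_c: "vec.span (c ` {..<CARD('n)}) = UNIV"
  using indep_c[of "CARD('n)"] by (intro independent_card_spans) auto

lemma coordinate_functional:
  assumes "m < CARD('n)"
  obtains T :: "'a ^ 'n \<Rightarrow> 'a" where "Vector_Spaces.linear (*s) (*) T"
    "\<And>k. k < CARD('n) \<Longrightarrow> T (c k) = (if k = m then 1 else 0)"
proof -
  have vs: "vector_space ((*) :: 'a \<Rightarrow> 'a \<Rightarrow> 'a)" by unfold_locales (auto simp: algebra_simps)
  have ind: "vec.independent (c ` {..<CARD('n)})" using indep_c[of "CARD('n)"] by simp
  obtain T where T: "Vector_Spaces.linear (*s) (*) T"
      "\<And>x. x \<in> c ` {..<CARD('n)} \<Longrightarrow> T x = (if x = c m then 1 else 0 :: 'a)"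
    using exists_linear_extension[OF vs ind, of "\<lambda>x. if x = c m then 1 else 0"] by metis
  have "inj_on c {..<CARD('n)}"
    using indep_c[of "CARD('n)"] by (intro eq_card_imp_inj_on) auto
  then have "T (c k) = (if k = m then 1 else 0)" if "k < CARD('n)" for k
    using T(2)[of "c k"] that assms by (auto dest: inj_onD)
  then show ?thesis using that[of T] T(1) by blast
qed

text \<open>\<open>S\<close> and \<open>T\<close> are the coordinates along the last two basis
  vectors. Modulo the other basis forms \<open>lin x\<close> is \<open>S x\<close> times
  \<open>?y\<close> plus \<open>T x\<close> times \<open>?z\<close>, and \<rho> sends it to
  \<open>[:T x, S x:]\<close>.\<close>

lemma exists_two_variables:
  assumes l: "2 \<le> CARD('n)"
  obtains a b \<rho> where
    "two_variables (ideal.span (lin ` c ` {..<CARD('n) - 2})) (lin (c (CARD('n) - 2)))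
      (lin (c (CARD('n) - 1))) a b \<rho>"
proof -
  let ?k = "CARD('n) - 2" and ?m = "CARD('n) - 1"
  let ?I = "ideal.span (lin ` c ` {..<?k})" and ?y = "lin (c ?k)" and ?z = "lin (c ?m)"
  obtain S where S: "Vector_Spaces.linear (*s) (*) S"
      "\<And>k. k < CARD('n) \<Longrightarrow> S (c k) = (if k = ?k then 1 else 0)"
    using coordinate_functional[of ?k] l by auto
  obtain T where T: "Vector_Spaces.linear (*s) (*) T"
      "\<And>k. k < CARD('n) \<Longrightarrow> T (c k) = (if k = ?m then 1 else 0)"
    using coordinate_functional[of ?m] l by auto
  interpret S: Vector_Spaces.linear "(*s)" "(*)" S by (rule S(1))
  interpret T: Vector_Spaces.linear "(*s)" "(*)" T by (rule T(1))
  define a where "a i = S (axis i 1)" for i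
  define b where "b i = T (axis i 1)" for i
  define \<rho> where "\<rho> = insertion (\<lambda>c. [:c:]) (\<lambda>i. [:b i, a i:])"
  have hom: "hom_on_ring \<rho>" unfolding \<rho>_def by (rule hom_insertion[OF hom_pCons0])
  have \<rho>_lin: "\<rho> (lin x) = [:T x, S x:]" for x
  proof -
    have "\<rho> (lin x) = (\<Sum>i\<in>UNIV. [:x $ i * b i, x $ i * a i:])"
      unfolding \<rho>_def insertion_lin[OF hom_pCons0] by (simp add: mult.commute[of "x $ _"])
    also have "\<dots> = [:\<Sum>i\<in>UNIV. x $ i * b i, \<Sum>i\<in>UNIV. x $ i * a i:]"
    proof -
      have "(\<Sum>i\<in>M. [:f i, g i:]) = [:\<Sum>i\<in>M. f i, \<Sum>i\<in>M. g i:]" for M :: "'n set" and f g :: "'n \<Rightarrow> 'a"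
        by (induction M rule: infinite_finite_induct) auto
      then show ?thesis .
    qed
    also have "\<dots> = [:T x, S x:]"
      unfolding linear_functional_dot[OF S(1), of x] linear_functional_dot[OF T(1), of x] a_def b_def ..
    finally show ?thesis .
  qed
  have expand: "lin x - (Const (S x) * ?y + Const (T x) * ?z) \<in> ?I" for x
  proof -
    have "x \<in> vec.span (c ` {..<CARD('n)})" using basis_c by simp
    then show ?thesis
    proof (induction rule: vec.span_induct_alt)
      case base
      then show ?case by (simp add: ideal.span_zero)
    next
      case (step r x x')
      then obtain k where k: "k < CARD('n)" "x = c k" by blast
      have "lin x - (Const (S x) * ?y + Const (T x) * ?z) \<in> ?I"
      proof (cases "k < ?k")
        case True
        then show ?thesis using S(2)[of k] T(2)[of k] k by (auto intro!: ideal.span_base)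
      next
        case False
        then have "k = ?k \<or> k = ?m" using k(1) by auto
        moreover have "?k \<noteq> ?m" using l by simp
        ultimately show ?thesis using S(2)[of k] T(2)[of k] k(1) unfolding k(2)
          by (auto simp: ideal.span_zero)
      qed
      then have "Const r * (lin x - (Const (S x) * ?y + Const (T x) * ?z)) +
          (lin x' - (Const (S x') * ?y + Const (T x') * ?z)) \<in> ?I"
        using step.IH by (intro ideal.span_add ideal.span_scale)
      then show ?case
        by (simp add: lin_add lin_scale S.add S.scale T.add T.scale Const_add Const_mult algebra_simps)
    qed
  qed
  have "two_variables ?I ?y ?z a b \<rho>"
  proof
    fix i show "Var i - (Const (a i) * ?y + Const (b i) * ?z) \<in> ?I"
      using expand[of "axis i 1"] by (simp add: lin_axis a_def b_def)
  next
    show "\<rho> p = 0" if "p \<in> ?I" for p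
      using that
    proof (induction rule: ideal.span_induct_alt)
      case base
      then show ?case by (rule hom_on_ring_zero[OF hom])
    next
      case (step r x y)
      then obtain k where "k < ?k" "x = lin (c k)" by blast
      then have "\<rho> x = 0" using \<rho>_lin S(2)[of k] T(2)[of k] by simp
      then show ?case using hom step by (simp add: hom_on_ring_def)
    qed
  next
    have "?k \<noteq> ?m" using l by simp
    then show "\<rho> ?y = [:0, 1:]" "\<rho> ?z = 1" using S(2) T(2) l by (auto simp: \<rho>_lin one_pCons)
  qed (auto simp: \<rho>_def)
  then show ?thesis using that by blast
qed

text \<open>Three ranges, counted from 0: below \<open>CARD('n) - 2\<close> the generic forms are
  regular; the next form comes from the two-variable argument; before the last one the quotient is
  generated by a single linear form.\<close>

lemma lefschetz_sequence:
  assumes B: "der.independent B"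
    and D: "der.span B = {\<delta> \<in> derivations. \<forall>H\<in>A. lin (v H) dvd \<delta> (lin (v H))}"
  obtains f :: "nat \<Rightarrow> ('a, 'n) mpoly" where "\<And>k. f k \<in> homogeneous_part 1"
    "\<And>k. k < CARD('n) \<Longrightarrow> lefschetz_mod (ideal.span (f ` {..<k} \<union> jac_gens Q)) (f k)"
proof (cases "2 \<le> CARD('n)")
  case False
  \<comment> \<open>With one variable the quotient is generated by that variable from the
    start.\<close>
  then have "CARD('n) = 1" using zero_less_card_finite[where 'a = 'n] by linarith
  then obtain i :: 'n where i: "\<And>j. j = i" by (metis card_1_singletonE UNIV_I singletonD)
  have "lefschetz_mod (ideal.span ((\<lambda>k. Var i) ` {..<k} \<union> jac_gens Q)) (Var i)" for k :: nat
  proof (rule lefschetz_mod_power_generator[where \<kappa> = "\<lambda>_. 1"])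
    fix j show "Var j - Const 1 * Var i \<in> ideal.span ((\<lambda>k. Var i) ` {..<k} \<union> jac_gens Q)"
      using i[of j] by (simp add: ideal.span_zero)
  qed simp_all
  then show ?thesis using that[of "\<lambda>_. Var i"] by simp
next
  case l: True
  let ?k = "CARD('n) - 2" and ?m = "CARD('n) - 1"
  let ?I = "ideal.span (lin ` c ` {..<?k})" and ?y = "lin (c ?k)" and ?z = "lin (c ?m)"
  let ?N = "ideal.span (lin ` c ` {..<?k} \<union> jac_gens Q)"
  obtain a b \<rho> where "two_variables ?I ?y ?z a b \<rho>"
    using exists_two_variables[OF l] by blast
  then interpret two: two_variables ?I ?y ?z a b \<rho> .
  obtain n0 where n0: "\<And>j. n0 \<le> j \<Longrightarrow> homogeneous_part j \<subseteq> ?N"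
    using artinian[OF l] by blast
  have IN: "?I \<subseteq> ?N" by (rule ideal.span_mono) blast
  obtain t where t: "lefschetz_mod ?N (?y - Const t * ?z)"
    using two.exists_lefschetz[OF ideal.subspace_span IN n0] by blast
  define f where "f k = (if k < ?k then lin (c k) else if k = ?k then ?y - Const t * ?z else ?z)" for k
  have im: "f ` {..<k} = lin ` c ` {..<k}" if "k \<le> ?k" for k
    unfolding f_def image_image using that by (intro image_cong) auto
  show ?thesis
  proof (rule that[of f])
    fix k show "f k \<in> homogeneous_part 1"
      unfolding f_def by (auto intro!: homogeneous_diff homogeneous_scale)
  next
    fix k assume k: "k < CARD('n)"
    consider "k < ?k" | "k = ?k" | "k = ?m" "?m \<noteq> ?k" "\<not> ?m < ?k" using k l by linarith
    then show "lefschetz_mod (ideal.span (f ` {..<k} \<union> jac_gens Q)) (f k)"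
    proof cases
      case 1
      then show ?thesis using nzd_mod_lefschetz[OF regular[OF B D, of k]] im[of k] by (simp add: f_def)
    next
      case 2
      then show ?thesis using t im[of ?k] by (simp add: f_def)
    next
      case 3
      let ?M = "ideal.span (f ` {..<k} \<union> jac_gens Q)"
      have "{..<k} = insert ?k {..<?k}" using 3(1) l by auto
      then have sub: "lin ` c ` {..<?k} \<subseteq> f ` {..<k}" and fk: "f ?k \<in> f ` {..<k}"
        using im[of ?k] by auto
      have IM: "?I \<subseteq> ?M" using sub by (intro ideal.span_mono) auto
      have fM: "?y - Const t * ?z \<in> ?M"
        using ideal.span_base[of "f ?k"] fk by (simp add: f_def)
      \<comment> \<open>Modulo \<open>?M\<close> the form \<open>?y\<close> is \<open>t\<close>
        times \<open>?z\<close>, which is substituted into \<open>a i\<close> times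
        \<open>?y\<close> plus \<open>b i\<close> times \<open>?z\<close>.\<close>
      have "Var i - Const (a i * t + b i) * ?z \<in> ?M" for i
      proof -
        have "Var i - Const (a i * t + b i) * ?z =
          (Var i - (Const (a i) * ?y + Const (b i) * ?z)) + Const (a i) * (?y - Const t * ?z)"
          by (simp add: Const_add Const_mult algebra_simps)
        also have "\<dots> \<in> ?M" using two.Var[of i] IM fM by (intro ideal.span_add ideal.span_scale) auto
        finally show ?thesis .
      qed
      then have "lefschetz_mod ?M ?z"
        by (intro lefschetz_mod_power_generator[where \<kappa> = "\<lambda>i. a i * t + b i"]) simp_all
      moreover have "f k = ?z" using 3 by (simp add: f_def)
      ultimately show ?thesis by simp
    qed
  qed
qed

end


section \<open>Quotient rings\<close>

text \<open>\<open>R\<close> is seen only through \<open>h\<close> and its kernel \<open>N\<close>,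
  so this serves both the Jacobian quotient and its further quotients; full rank is transferred by
  choosing representatives.\<close>

lemma has_SLP_with_hom:
  fixes h :: "('a::comm_ring_1, 'n::finite) mpoly \<Rightarrow> 'r"
  assumes mult: "\<And>x y. h (x * y) = h x \<otimes>\<^bsub>R\<^esub> h y" and one: "h 1 = \<one>\<^bsub>R\<^esub>" and R: "Group.monoid R"
    and ker: "\<And>x y. h x = h y \<longleftrightarrow> x - y \<in> N"
    and a: "a \<in> homogeneous_part 1" and lef: "lefschetz_mod N a"
  shows "has_SLP_with R (\<lambda>i. h ` homogeneous_part i) (h a)"
  unfolding has_SLP_with_def
proof (intro conjI allI impI)
  show "h a \<in> h ` homogeneous_part 1" using a by blast
  fix i s :: nat assume "1 \<le> s"
  interpret Group.monoid R by fact
  have pow: "h (a ^ k) = h a [^]\<^bsub>R\<^esub> k" for k :: nat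
    by (induction k) (simp_all add: one power_Suc2 mult nat_pow_Suc del: power_Suc)
  have ax: "h a [^]\<^bsub>R\<^esub> s \<otimes>\<^bsub>R\<^esub> h x = h (a ^ s * x)" for x by (simp add: mult pow)
  have hom: "a ^ s * x \<in> homogeneous_part (i + s)" if "x \<in> homogeneous_part i" for x
    using homogeneous_mult[OF homogeneous_power[OF a, of s] that] by (simp add: add.commute)
  consider "\<forall>x\<in>homogeneous_part i. a ^ s * x \<in> N \<longrightarrow> x \<in> N" |
    "\<forall>w\<in>homogeneous_part (i + s). \<exists>x\<in>homogeneous_part i. a ^ s * x - w \<in> N"
    using lef unfolding lefschetz_mod_def by blast
  then show "full_rank (\<lambda>x. h a [^]\<^bsub>R\<^esub> s \<otimes>\<^bsub>R\<^esub> x) (h ` homogeneous_part i) (h ` homogeneous_part (i + s))"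
  proof cases
    case 1
    have "inj_on (\<lambda>x. h a [^]\<^bsub>R\<^esub> s \<otimes>\<^bsub>R\<^esub> x) (h ` homogeneous_part i)"
    proof (rule inj_onI, elim imageE)
      fix p q x y
      assume eq: "h a [^]\<^bsub>R\<^esub> s \<otimes>\<^bsub>R\<^esub> p = h a [^]\<^bsub>R\<^esub> s \<otimes>\<^bsub>R\<^esub> q"
        and pq: "p = h x" "x \<in> homogeneous_part i" "q = h y" "y \<in> homogeneous_part i"
      have "a ^ s * (x - y) \<in> N" using eq unfolding pq ax ker by (simp add: right_diff_distrib)
      moreover have "x - y \<in> homogeneous_part i" using pq by (intro homogeneous_diff)
      ultimately show "p = q" using 1 unfolding pq ker by blast
    qed
    then show ?thesis by (simp add: full_rank_def)
  next
    case 2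
    have "(\<lambda>x. h a [^]\<^bsub>R\<^esub> s \<otimes>\<^bsub>R\<^esub> x) ` h ` homogeneous_part i = h ` homogeneous_part (i + s)"
    proof (intro equalityI subsetI; elim imageE)
      fix q p x assume "q = h a [^]\<^bsub>R\<^esub> s \<otimes>\<^bsub>R\<^esub> p" "p = h x" "x \<in> homogeneous_part i"
      then show "q \<in> h ` homogeneous_part (i + s)" using hom by (simp add: ax)
    next
      fix q w assume w: "q = h w" "w \<in> homogeneous_part (i + s)"
      then obtain x where x: "x \<in> homogeneous_part i" "a ^ s * x - w \<in> N" using 2 by blast
      then have "q = h a [^]\<^bsub>R\<^esub> s \<otimes>\<^bsub>R\<^esub> h x" unfolding ax w(1) using ker by metis
      then show "q \<in> (\<lambda>x. h a [^]\<^bsub>R\<^esub> s \<otimes>\<^bsub>R\<^esub> x) ` h ` homogeneous_part i" using x(1) by blast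
    qed
    then show ?thesis by (simp add: full_rank_def)
  qed
qed

section \<open>Comparison with ideals and quotients of ring records\<close>

lemma mpoly_ring_simps:
  "carrier mpoly_ring = UNIV" "x \<otimes>\<^bsub>mpoly_ring\<^esub> y = x * y" "\<one>\<^bsub>mpoly_ring\<^esub> = 1"
  "x \<oplus>\<^bsub>mpoly_ring\<^esub> y = x + y" "\<zero>\<^bsub>mpoly_ring\<^esub> = 0"
  by (simp_all add: ring_of_type_algebra_def)

lemma mpoly_ring_cring: "cring (mpoly_ring :: ('a::comm_ring_1, 'n::finite) mpoly ring)"
  by (rule cring_from_type_algebra)

lemma mpoly_ring_minus:
  fixes x y :: "('a::comm_ring_1, 'n::finite) mpoly"
  shows "x \<ominus>\<^bsub>mpoly_ring\<^esub> y = x - y"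
proof -
  interpret cring "mpoly_ring :: ('a, 'n) mpoly ring" by (rule mpoly_ring_cring)
  have "\<ominus>\<^bsub>mpoly_ring\<^esub> y = - y"
    by (rule minus_equality) (simp_all add: mpoly_ring_simps)
  then show ?thesis by (simp add: a_minus_def mpoly_ring_simps)
qed

lemma ideal_mpoly_ring_iff:
  fixes I :: "('a::comm_ring_1, 'n::finite) mpoly set"
  shows "Ideal.ideal I mpoly_ring \<longleftrightarrow> ideal.subspace I"
proof
  interpret R: cring "mpoly_ring :: ('a, 'n) mpoly ring" by (rule mpoly_ring_cring)
  {
    assume "Ideal.ideal I mpoly_ring"
    then interpret Ideal.ideal I "mpoly_ring :: ('a, 'n) mpoly ring" .
    show "ideal.subspace I"
      using zero_closed a_closed I_l_closed by (intro ideal.subspaceI) (auto simp: mpoly_ring_simps)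
  }
  {
    assume I: "ideal.subspace I"
    show "Ideal.ideal I mpoly_ring"
    proof (rule idealI)
      show "subgroup I (add_monoid mpoly_ring)"
      proof (rule R.add.subgroupI)
        show "I \<noteq> {}" using ideal.subspace_0[OF I] by blast
        fix x assume x: "x \<in> I"
        have "\<ominus>\<^bsub>mpoly_ring\<^esub> x = - x"
          by (rule R.minus_equality) (simp_all add: mpoly_ring_simps)
        then show "\<ominus>\<^bsub>mpoly_ring\<^esub> x \<in> I" using ideal.subspace_neg[OF I x] by simp
      qed (use ideal.subspace_add[OF I] in \<open>auto simp: mpoly_ring_simps\<close>)
    qed (use ideal.subspace_scale[OF I] in \<open>auto simp: mpoly_ring_simps mult.commute R.ring_axioms\<close>)
  }
qed

lemma genideal_mpoly_ring:
  fixes Y :: "('a::comm_ring_1, 'n::finite) mpoly set"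
  shows "genideal mpoly_ring Y = ideal.span Y"
proof
  interpret R: cring "mpoly_ring :: ('a, 'n) mpoly ring" by (rule mpoly_ring_cring)
  show "genideal mpoly_ring Y \<subseteq> ideal.span Y"
    by (rule R.genideal_minimal) (auto simp: ideal_mpoly_ring_iff intro: ideal.span_base)
  have "Ideal.ideal (genideal mpoly_ring Y) (mpoly_ring :: ('a, 'n) mpoly ring)"
    by (rule R.genideal_ideal) (simp add: mpoly_ring_simps)
  then show "ideal.span Y \<subseteq> genideal mpoly_ring Y"
    using R.genideal_self[of Y] by (intro ideal.span_minimal) (auto simp: ideal_mpoly_ring_iff mpoly_ring_simps)
qed

text \<open>The ideal generated by the classes of \<open>f 0, ..., f (k - 1)\<close> pulls back to
  \<open>N k\<close>. An iterated quotient is therefore a quotient of the polynomial ring with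
  kernel \<open>N k\<close>, to which \<open>has_SLP_with_hom\<close> applies.\<close>

lemma k_SLP_mpoly_quotient:
  fixes Z :: "('a::comm_ring_1, 'n::finite) mpoly set" and f :: "nat \<Rightarrow> ('a, 'n) mpoly"
  assumes f: "\<And>k. f k \<in> homogeneous_part 1"
    and lef: "\<And>k. k < l \<Longrightarrow> lefschetz_mod (ideal.span (f ` {..<k} \<union> Z)) (f k)"
    and l: "0 < l"
  shows "k_SLP (mpoly_ring Quot (genideal mpoly_ring Z))
    (quot_grading mpoly_ring homogeneous_part (genideal mpoly_ring Z)) l"
proof -
  let ?S = "mpoly_ring :: ('a, 'n) mpoly ring"
  interpret S: cring ?S by (rule mpoly_ring_cring)
  define J where "J = ideal.span Z"
  have J: "genideal ?S Z = J" by (simp add: J_def genideal_mpoly_ring)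
  interpret J: Ideal.ideal J ?S by (simp add: ideal_mpoly_ring_iff J_def)
  define R where "R = ?S Quot J"
  interpret R: cring R unfolding R_def by (rule J.quotient_is_cring[OF S.cring_axioms])
  define h where "h x = J +>\<^bsub>?S\<^esub> x" for x
  have "h \<in> ring_hom ?S R" using J.rcos_ring_hom by (simp add: R_def h_def[abs_def])
  then have h: "h x \<in> carrier R" "h (x * y) = h x \<otimes>\<^bsub>R\<^esub> h y" "h (x + y) = h x \<oplus>\<^bsub>R\<^esub> h y" "h 1 = \<one>\<^bsub>R\<^esub>" for x y
    using ring_hom_closed[of h ?S R] ring_hom_mult[of h ?S R] ring_hom_add[of h ?S R] ring_hom_one[of h ?S R]
    by (auto simp: mpoly_ring_simps)
  have h_eq: "h x = h y \<longleftrightarrow> x - y \<in> J" for x y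
    using S.quotient_eq_iff_same_a_r_cos[OF J.ideal_axioms, of x y]
    by (simp add: h_def mpoly_ring_simps mpoly_ring_minus)
  have carrier_R: "carrier R = range h"
    by (auto simp: R_def FactRing_def A_RCOSETS_def' h_def mpoly_ring_simps)
  have h0: "h 0 = \<zero>\<^bsub>R\<^esub>"
    using h(3)[of 0 0] h(1)[of 0] by (metis add_0 R.add.r_cancel_one')
  have hm: "h (x - y) = h x \<ominus>\<^bsub>R\<^esub> h y" for x y
  proof -
    have "h (x - y) \<oplus>\<^bsub>R\<^esub> h y = h x" by (simp flip: h(3))
    then show ?thesis using h(1) by (metis R.add.inv_solve_right a_minus_def)
  qed
  define N where "N k = ideal.span (f ` {..<k} \<union> Z)" for k
  define I where "I k = genideal R (h ` f ` {..<k})" for k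
  have I_ideal: "Ideal.ideal (I k) R" for k
    unfolding I_def using h(1) by (intro R.genideal_ideal) auto
  have JN: "J \<subseteq> N k" for k unfolding J_def N_def by (intro ideal.span_mono) auto
  have I_iff: "h x \<in> I k \<longleftrightarrow> x \<in> N k" for x k
  proof
    interpret I: Ideal.ideal "I k" R by (rule I_ideal)
    {
      assume "x \<in> N k"
      then show "h x \<in> I k"
        unfolding N_def
      proof (induction rule: ideal.span_induct_alt)
        case base
        then show ?case using h0 I.zero_closed by simp
      next
        case (step r x y)
        have "h x \<in> I k"
        proof (cases "x \<in> Z")
          case True
          then have "h x = h 0" unfolding h_eq J_def by (simp add: ideal.span_base)
          then show ?thesis using h0 I.zero_closed by simp
        next
          case False
          then have "h x \<in> h ` f ` {..<k}" using step by blast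
          then show ?thesis unfolding I_def using R.genideal_self[of "h ` f ` {..<k}"] h(1) by blast
        qed
        then show ?case using step.IH I.I_l_closed[OF _ h(1)] I.a_closed by (simp add: h)
      qed
    }
    {
      assume "h x \<in> I k"
      \<comment> \<open>The image of \<open>N k\<close> is an ideal containing the generators. Since
        \<open>J\<close> lies in \<open>N k\<close>, an \<open>x\<close> whose class is in that
        image is itself in \<open>N k\<close>.\<close>
      moreover have "I k \<subseteq> h ` N k"
        unfolding I_def
      proof (rule R.genideal_minimal)
        have sub: "ideal.subspace (N k)" by (simp add: N_def)
        show "h ` f ` {..<k} \<subseteq> h ` N k" by (auto simp: N_def intro: ideal.span_base)
        show "Ideal.ideal (h ` N k) R"
        proof (rule idealI)
          show "subgroup (h ` N k) (add_monoid R)"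
          proof (rule R.add.subgroupI)
            show "h ` N k \<noteq> {}" using ideal.subspace_0[OF sub] by blast
            fix p assume "p \<in> h ` N k"
            then obtain x where x: "p = h x" "x \<in> N k" by blast
            have "h (0 - x) = \<ominus>\<^bsub>R\<^esub> p" unfolding hm h0 x(1) using h(1) by (simp add: a_minus_def)
            moreover have "0 - x \<in> N k" using ideal.subspace_neg[OF sub x(2)] by simp
            ultimately show "\<ominus>\<^bsub>R\<^esub> p \<in> h ` N k" by (metis imageI)
            fix q assume "q \<in> h ` N k"
            then obtain y where y: "q = h y" "y \<in> N k" by blast
            have "x + y \<in> N k" using x(2) y(2) by (rule ideal.subspace_add[OF sub])
            then show "p \<oplus>\<^bsub>R\<^esub> q \<in> h ` N k" unfolding x(1) y(1) h(3)[symmetric] by (rule imageI)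
          qed (use h(1) in auto)
          fix p q assume "p \<in> h ` N k" "q \<in> carrier R"
          then obtain x y where xy: "p = h x" "x \<in> N k" "q = h y" unfolding carrier_R by blast
          have "y * x \<in> N k" using xy(2) by (rule ideal.subspace_scale[OF sub])
          then show "q \<otimes>\<^bsub>R\<^esub> p \<in> h ` N k" "p \<otimes>\<^bsub>R\<^esub> q \<in> h ` N k"
            unfolding xy(1,3) h(2)[symmetric] by (simp_all add: mult.commute)
        qed (rule R.ring_axioms)
      qed
      ultimately obtain y where y: "h x = h y" "y \<in> N k" by blast
      then have "x - y \<in> N k" using JN h_eq by blast
      then have "(x - y) + y \<in> N k" using y(2) unfolding N_def by (rule ideal.span_add)
      then show "x \<in> N k" by simp
    }
  qed
  have grading: "quot_grading ?S homogeneous_part J = (\<lambda>i. h ` homogeneous_part i)"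
    by (simp add: quot_grading_def h_def[abs_def])
  have "has_SLP_with R (\<lambda>i. h ` homogeneous_part i) (h (f 0))"
    using h(2,4) R.monoid_axioms h_eq f[of 0] lef[OF l]
    by (intro has_SLP_with_hom) (simp_all add: J_def)
  moreover have "has_SLP_with (R Quot I k) (quot_grading R (\<lambda>i. h ` homogeneous_part i) (I k))
      (I k +>\<^bsub>R\<^esub> h (f k))" if k: "k < l" for k
  proof -
    interpret I: Ideal.ideal "I k" R by (rule I_ideal)
    interpret RI: cring "R Quot I k" by (rule I.quotient_is_cring[OF R.cring_axioms])
    define g where "g x = I k +>\<^bsub>R\<^esub> h x" for x
    note hom = I.rcos_ring_hom
    have g: "g x \<in> carrier (R Quot I k)" "g (x * y) = g x \<otimes>\<^bsub>R Quot I k\<^esub> g y" "g 1 = \<one>\<^bsub>R Quot I k\<^esub>" for x y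
      using ring_hom_closed[OF hom h(1)] ring_hom_mult[OF hom h(1) h(1)] ring_hom_one[OF hom]
      by (simp_all add: g_def h)
    have g_eq: "g x = g y \<longleftrightarrow> x - y \<in> N k" for x y
      using R.quotient_eq_iff_same_a_r_cos[OF I.ideal_axioms h(1) h(1), of x y] I_iff
      by (simp add: g_def flip: hm)
    have "has_SLP_with (R Quot I k) (\<lambda>i. g ` homogeneous_part i) (g (f k))"
      using g RI.monoid_axioms g_eq f[of k] lef[OF k] by (intro has_SLP_with_hom) (simp_all add: N_def)
    then show ?thesis by (simp add: quot_grading_def g_def[abs_def] image_image)
  qed
  \<comment> \<open>\<open>k_SLP\<close> numbers its elements from 1, whereas \<open>f\<close>
    starts at 0.\<close>
  moreover have "(\<lambda>i. h (f (i - 1))) ` {1..i - 1} = h ` f ` {..<i - 1}" for i :: nat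
  proof -
    have "(\<lambda>i. i - 1) ` {1..i - 1} = {..<i - 1}" for i :: nat
      by (auto simp: image_iff intro!: bexI[of _ "Suc _"])
    then show ?thesis by (simp flip: image_image[of "\<lambda>k. h (f k)" "\<lambda>i. i - 1"] image_image[of h f])
  qed
  ultimately show ?thesis
    unfolding J k_SLP_def R_def[symmetric] grading Let_def using f
    by (intro exI[of _ "\<lambda>i. h (f (i - 1))"] conjI ballI) (auto simp: I_def)
qed

section \<open>Free arrangements and the choice of generic data\<close>

theorem theorem8p2:
  fixes A :: "('a::field_char_0 ^ 'n::finite) set set"
    and \<alpha> :: "('a ^ 'n) set \<Rightarrow> ('a, 'n) mpoly"
  assumes "central_arrangement A \<alpha>"
    and "free_arrangement A \<alpha>"
  shows "k_SLP (mpoly_ring Quot (jacobian_ideal A \<alpha>))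
           (quot_grading mpoly_ring homogeneous_part (jacobian_ideal A \<alpha>)) CARD('n)"
proof -
  have fin: "finite A" and "\<And>H. H \<in> A \<Longrightarrow> \<alpha> H \<in> homogeneous_part 1"
    and nz: "\<And>H. H \<in> A \<Longrightarrow> \<alpha> H \<noteq> 0" and ker: "\<And>H. H \<in> A \<Longrightarrow> H = {x. eval_mpoly x (\<alpha> H) = 0}"
    using assms(1) unfolding central_arrangement_def by blast+
  then have "\<forall>H\<in>A. \<exists>x. \<alpha> H = lin x" by (meson homogeneous_1_lin)
  then obtain v where v: "\<And>H. H \<in> A \<Longrightarrow> \<alpha> H = lin (v H)" by metis
  have kerv: "H = {x. dot (v H) x = 0}" if "H \<in> A" for H
    using ker[OF that] unfolding v[OF that] eval_mpoly_lin .
  have v0: "v H \<noteq> 0" if "H \<in> A" for H using nz[OF that] unfolding v[OF that] by simp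
  interpret arrangement_forms A v
  proof
    fix H K assume HK: "H \<in> A" "K \<in> A" "H \<noteq> K"
    show "v H \<notin> vec.span {v K}"
    proof
      assume "v H \<in> vec.span {v K}"
      then obtain t where t: "v H = t *s v K" by (auto simp: vec.span_singleton)
      then have "t \<noteq> 0" using v0[OF HK(1)] by auto
      have "dot (v H) x = t * dot (v K) x" for x
        by (simp add: t sum_distrib_left mult.assoc)
      then have "{x. dot (v H) x = 0} = {x. dot (v K) x = 0}" using \<open>t \<noteq> 0\<close> by simp
      then show False using kerv[OF HK(1)] kerv[OF HK(2)] HK(3) by simp
    qed
  qed (use fin v0 in auto)
  \<comment> \<open>The empty set yields independence of \<open>c\<close> itself, the pairs
    genericity with respect to any two defining forms.\<close>
  let ?F = "insert {} ((\<lambda>(H, K). {v H, v K}) ` (A \<times> A))"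
  have "finite ?F" "\<And>F. F \<in> ?F \<Longrightarrow> finite F" using fin by auto
  then obtain c :: "nat \<Rightarrow> 'a ^ 'n" where
    c: "\<And>k F. F \<in> ?F \<Longrightarrow> k + card F < CARD('n) \<Longrightarrow> c k \<notin> vec.span (c ` {..<k} \<union> F)"
    using exists_generic_vectors[of ?F] by blast
  have "finite (v ` A)" "0 \<notin> v ` A" using fin v0 by force+
  then obtain w :: "'a ^ 'n" where w: "\<And>x. x \<in> v ` A \<Longrightarrow> dot x w \<noteq> 0"
    using exists_nonvanishing_vector by metis
  interpret generic_forms A v c w
  proof
    show "c k \<notin> vec.span (c ` {..<k})" if "k < CARD('n)" for k using c[of "{}" k] that by simp
    show "c k \<notin> vec.span (c ` {..<k} \<union> {v H, v K})"
      if "k + 2 < CARD('n)" "H \<in> A" "K \<in> A" for k H K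
    proof -
      \<comment> \<open>Only a bound, since the pair collapses for \<open>H = K\<close>.\<close>
      have "card {v H, v K} \<le> 2" by (simp add: card_insert_if)
      then have "k + card {v H, v K} < CARD('n)" using that(1) by linarith
      then show ?thesis using that by (intro c) auto
    qed
    show "dot (v H) w \<noteq> 0" if "H \<in> A" for H using w that by blast
  qed
  obtain B where B: "der.independent B" "der.span B = log_derivations A \<alpha>"
    using assms(2) unfolding free_arrangement_def by blast
  have D: "der.span B = {\<delta> \<in> derivations. \<forall>H\<in>A. lin (v H) dvd \<delta> (lin (v H))}"
    unfolding B(2) log_derivations_def by (simp add: v cong: conj_cong ball_cong)
  obtain f :: "nat \<Rightarrow> ('a, 'n) mpoly" where f: "\<And>k. f k \<in> homogeneous_part 1"
    "\<And>k. k < CARD('n) \<Longrightarrow> lefschetz_mod (ideal.span (f ` {..<k} \<union> jac_gens Q)) (f k)"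
    by (rule lefschetz_sequence[OF B(1) D]) (rule that)
  have "defining_poly A \<alpha> = Q" unfolding defining_poly_def Q_def using v by (intro prod.cong) auto
  then have "jacobian_ideal A \<alpha> = genideal mpoly_ring (jac_gens Q)" by (simp add: jacobian_ideal_def)
  then show ?thesis using k_SLP_mpoly_quotient[OF f, of "CARD('n)"] by simp
qed

end
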